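(* Let $\theta\in\mathbb{R}$ and let $\Phi:\mathbb{C}_\theta\to\mathbb{C}_{1/2}$ be holomorphic. Then $\Phi$ generates a composition-differentiation operator $D_\Phi f=f'\circ\Phi$ on $\mathcal{D}$ (that is, $f'\circ\Phi\in\mathcal{D}$ for every $f\in\mathcal{D}$) if, and only if, $\Phi$ has the form $$\Phi(s)=c_0s+\phi(s),$$ where $c_0$ is a non-negative integer and $\phi\in\mathcal{D}$.
   Context: For $\theta\in\mathbb{R}$, $\mathbb{C}_\theta=\{s\in\mathbb{C}:\Re(s)>\theta\}$. $\mathcal{D}$ denotes the class of functions on a half-plane that are represented by a Dirichlet series $\sum_{n\ge1}a_nn^{-s}$ converging in some half-plane $\mathbb{C}_\sigma$. *)

theory Defs
  imports "HOL-Analysis.Analysis"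
begin

definition half_plane :: "real \<Rightarrow> complex set" where
  "half_plane \<theta> = {s. Re s > \<theta>}"

text \<open>The n-th term (n \<ge> 1) of the Dirichlet series with coefficients a at s,
  namely a n * n^(-s). Coefficients are indexed from 1; index 0 is ignored.\<close>
definition dir_term :: "(nat \<Rightarrow> complex) \<Rightarrow> complex \<Rightarrow> nat \<Rightarrow> complex" where
  "dir_term a s n = a (Suc n) / (of_nat (Suc n)) powr s"

definition in_D :: "real \<Rightarrow> (complex \<Rightarrow> complex) \<Rightarrow> bool" where
  "in_D \<theta> g \<longleftrightarrow> (\<exists>(a :: nat \<Rightarrow> complex) (\<sigma> :: real).
      (\<forall>s \<in> half_plane \<sigma>. summable (dir_term a s)) \<and>
      (\<forall>s \<in> half_plane \<sigma> \<inter> half_plane \<theta>. dir_term a s sums g s))"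

end

theory Submission
  imports Defs "HOL-Complex_Analysis.Complex_Analysis"
begin

text \<open>
  Necessity: applying the operator to \<open>n\<^bsup>-s\<^esup>\<close> shows that \<open>n\<^bsup>-\<Phi>(s)\<^esup>\<close> is an ordinary Dirichlet series for
  every \<open>n \<ge> 2\<close>. If \<open>m\<close> is the index of its leading term, taking logarithms gives
  \<open>\<Phi>(s) = (log m / log n) s + \<phi>(s)\<close> where \<open>\<phi>\<close> is bounded far to the right and is a Dirichlet series
  in the rational frequencies \<open>k / m ^ j\<close>. Boundedness makes \<open>c = log m / log n\<close> independent of \<open>n\<close>,
  so \<open>n powr c\<close> is an integer for all \<open>n\<close>, which forces \<open>c\<close> to be a natural number. The cases
  \<open>n = 2\<close> and \<open>n = 3\<close> show that the frequencies of \<open>\<phi>\<close> have both a power of 2 and a power of 3 as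
  denominators, so they are integers.

  Sufficiency: let \<open>b\<close> be the constant term of \<open>\<phi>\<close> and \<open>w = \<phi> - b\<close>, which is small in norm far to the
  right. For \<open>c \<ge> 1\<close> insert \<open>n\<^bsup>-\<Phi>(s)\<^esup> = n\<^bsup>-b\<^esup> n\<^bsup>-cs\<^esup> exp (-w(s) log n)\<close> into the
  Dirichlet series of \<open>f'\<close>. For \<open>c = 0\<close> one has \<open>Re b > 1/2\<close>, and the Taylor series of \<open>f'\<close> at \<open>b\<close>
  can be composed with \<open>w\<close>.
\<close>

subsection \<open>Absolutely convergent general Dirichlet series\<close>

text \<open>Series with frequencies \<open>log q\<close>, \<open>q \<in> M\<close>. The bound \<open>B\<close> on the weighted \<open>\<ell>\<^sup>1\<close> norm is
  carried along because for \<open>M\<close> closed under multiplication these series form a Banach algebra,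
  which gives products, infinite sums and power series with control of convergence.\<close>

definition gds_coeffs :: "real set \<Rightarrow> real \<Rightarrow> real \<Rightarrow> (real \<Rightarrow> complex) \<Rightarrow> (complex \<Rightarrow> complex) \<Rightarrow> bool" where
  "gds_coeffs M \<sigma> B a g \<longleftrightarrow>
     (\<exists>T\<le>B. ((\<lambda>q. cmod (a q) * q powr (-\<sigma>)) has_sum T) M) \<and>
     (\<forall>s. Re s \<ge> \<sigma> \<longrightarrow> ((\<lambda>q. a q * of_real q powr (-s)) has_sum g s) M)"

definition gds :: "real set \<Rightarrow> real \<Rightarrow> real \<Rightarrow> (complex \<Rightarrow> complex) \<Rightarrow> bool" where
  "gds M \<sigma> B g \<longleftrightarrow> (\<exists>a. gds_coeffs M \<sigma> B a g)"

lemma norm_powr_neg: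
  fixes q :: real
  assumes "q > 0"
  shows "cmod (of_real q powr (-s)) = q powr (- Re s)"
  using assms by (simp add: norm_powr_real_powr)

lemma gds_cong:
  assumes "gds M \<sigma> B g" "\<And>s. Re s \<ge> \<sigma> \<Longrightarrow> g s = h s"
  shows "gds M \<sigma> B h"
  using assms unfolding gds_def gds_coeffs_def by auto

lemma gds_mono:
  assumes "gds M \<sigma> B g" "M \<subseteq> M'" "B \<le> B'"
  shows "gds M' \<sigma> B' g"
proof -
  obtain a T where a: "T \<le> B" "((\<lambda>q. cmod (a q) * q powr (-\<sigma>)) has_sum T) M"
     "\<And>s. Re s \<ge> \<sigma> \<Longrightarrow> ((\<lambda>q. a q * of_real q powr (-s)) has_sum g s) M"
    using assms(1) unfolding gds_def gds_coeffs_def by blast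
  define b where "b q = (if q \<in> M then a q else 0)" for q
  have "((\<lambda>q. cmod (b q) * q powr (-\<sigma>)) has_sum T) M'"
    using a(2) assms(2) by (subst has_sum_cong_neutral[where T=M and g="\<lambda>q. cmod (a q) * q powr (-\<sigma>)"]) (auto simp: b_def)
  moreover have "((\<lambda>q. b q * of_real q powr (-s)) has_sum g s) M'" if "Re s \<ge> \<sigma>" for s
    using a(3)[OF that] assms(2)
    by (subst has_sum_cong_neutral[where T=M and g="\<lambda>q. a q * of_real q powr (-s)"]) (auto simp: b_def)
  moreover have "T \<le> B'" using a(1) assms(3) by simp
  ultimately show ?thesis unfolding gds_def gds_coeffs_def by blast
qed

lemma gds_nonneg:
  assumes "gds M \<sigma> B g"
  shows "B \<ge> 0"
proof -
  obtain a T where a: "T \<le> B" "((\<lambda>q. cmod (a q) * q powr (-\<sigma>)) has_sum T) M"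
    using assms(1) unfolding gds_def gds_coeffs_def by blast
  have "T \<ge> 0" by (rule has_sum_nonneg[OF a(2)]) auto
  with a(1) show ?thesis by simp
qed

lemma norm_term_le:
  fixes q :: real
  assumes "q \<ge> 1" "Re s \<ge> \<sigma>"
  shows "cmod (c * of_real q powr (-s)) \<le> cmod c * q powr (-\<sigma>)"
  using assms by (auto simp: norm_mult norm_powr_neg intro!: mult_left_mono powr_mono)

lemma norm_le_weighted_sum:
  assumes M: "M \<subseteq> {1..}" and s: "Re s \<ge> \<sigma>"
    and T: "((\<lambda>q. cmod (a q) * q powr (-\<sigma>)) has_sum T) M"
    and g: "((\<lambda>q. a q * of_real q powr (-s)) has_sum x) M"
  shows "cmod x \<le> T"
proof -
  have *: "cmod (a q * of_real q powr (-s)) \<le> cmod (a q) * q powr (-\<sigma>)" if "q \<in> M" for q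
    using norm_term_le[OF _ s] that M by auto
  have sm: "(\<lambda>q. cmod (a q * of_real q powr (-s))) summable_on M"
    by (rule summable_on_comparison_test[OF has_sum_imp_summable[OF T]]) (use * in auto)
  have "cmod x \<le> infsum (\<lambda>q. cmod (a q * of_real q powr (-s))) M"
    using norm_infsum_bound[OF sm] infsumI[OF g] by simp
  also have "\<dots> \<le> T"
    by (rule has_sum_mono[OF has_sum_infsum[OF sm] T]) (use * in auto)
  finally show ?thesis .
qed

lemma gds_bound:
  assumes "gds M \<sigma> B g" "M \<subseteq> {1..}" "Re s \<ge> \<sigma>"
  shows "cmod (g s) \<le> B"
proof -
  obtain a T where a: "T \<le> B" "((\<lambda>q. cmod (a q) * q powr (-\<sigma>)) has_sum T) M"
     "\<And>s. Re s \<ge> \<sigma> \<Longrightarrow> ((\<lambda>q. a q * of_real q powr (-s)) has_sum g s) M"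
    using assms(1) unfolding gds_def gds_coeffs_def by blast
  show ?thesis
    using norm_le_weighted_sum[OF assms(2,3) a(2) a(3)[OF assms(3)]] a(1) by simp
qed

text \<open>Different indices may share a frequency. Regrouping along the fibres of
  \<open>lam\<close> collects their coefficients, and the triangle inequality in each fibre keeps
  the weighted norm at most \<open>T\<close>. Later constructions only have to exhibit an absolutely
  summable family.\<close>

lemma gds_of_family:
  assumes lam: "\<And>i. i \<in> I \<Longrightarrow> lam i \<in> M" and M: "M \<subseteq> {1..}"
    and S: "((\<lambda>i. cmod (c i) * lam i powr (-\<sigma>)) has_sum T) I" "T \<le> B"
    and G: "\<And>s. Re s \<ge> \<sigma> \<Longrightarrow> ((\<lambda>i. c i * of_real (lam i) powr (-s)) has_sum g s) I"
  shows "gds M \<sigma> B g"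
proof -
  define A where "A q = {i\<in>I. lam i = q}" for q
  have bij: "bij_betw (\<lambda>i. (lam i, i)) I (Sigma M A)"
    by (rule bij_betw_byWitness[where f'=snd]) (auto simp: A_def lam)
  have c_abs: "(\<lambda>i. cmod (c i)) summable_on A q" if "q \<in> M" for q
  proof -
    have "q > 0" using that M by force
    have "(\<lambda>i. cmod (c i) * lam i powr (-\<sigma>)) summable_on A q"
      using has_sum_imp_summable[OF S(1)] by (rule summable_on_subset_banach) (auto simp: A_def)
    then have "(\<lambda>i. cmod (c i) * q powr (-\<sigma>)) summable_on A q"
      by (rule summable_on_cong[THEN iffD1, rotated]) (auto simp: A_def)
    then show ?thesis using \<open>q > 0\<close> by (auto simp: summable_on_cmult_left')
  qed
  define a where "a q = infsum c (A q)" for q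
  define N where "N q = infsum (\<lambda>i. cmod (c i)) (A q)" for q
  have aN: "cmod (a q) \<le> N q" if "q \<in> M" for q
    unfolding a_def N_def using c_abs[OF that] by (rule norm_infsum_bound)
  have NT: "((\<lambda>q. N q * q powr (-\<sigma>)) has_sum T) M"
  proof (rule has_sum_SigmaD[where B=A and f="\<lambda>(q,i). cmod (c i) * lam i powr (-\<sigma>)"])
    show "((\<lambda>(q,i). cmod (c i) * lam i powr (-\<sigma>)) has_sum T) (Sigma M A)"
      using S(1) by (subst has_sum_reindex_bij_betw[OF bij, symmetric]) simp
    fix q assume q: "q \<in> M"
    have "((\<lambda>i. cmod (c i) * q powr (-\<sigma>)) has_sum N q * q powr (-\<sigma>)) (A q)"
      unfolding N_def by (intro has_sum_cmult_left has_sum_infsum c_abs q)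
    then show "((\<lambda>y. case (q, y) of (q, i) \<Rightarrow> cmod (c i) * lam i powr (-\<sigma>)) has_sum N q * q powr (-\<sigma>)) (A q)"
      by (rule has_sum_cong[THEN iffD1, rotated]) (auto simp: A_def)
  qed
  have sm: "(\<lambda>q. cmod (a q) * q powr (-\<sigma>)) summable_on M"
    by (rule summable_on_comparison_test[OF has_sum_imp_summable[OF NT]]) (auto intro!: mult_right_mono aN)
  have "infsum (\<lambda>q. cmod (a q) * q powr (-\<sigma>)) M \<le> T"
    by (rule has_sum_mono[OF has_sum_infsum[OF sm] NT]) (auto intro!: mult_right_mono aN)
  moreover have "((\<lambda>q. a q * of_real q powr (-s)) has_sum g s) M" if s: "Re s \<ge> \<sigma>" for s
  proof (rule has_sum_SigmaD[where B=A and f="\<lambda>(q,i). c i * of_real (lam i) powr (-s)"])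
    show "((\<lambda>(q,i). c i * of_real (lam i) powr (-s)) has_sum g s) (Sigma M A)"
      using G[OF s] by (subst has_sum_reindex_bij_betw[OF bij, symmetric]) simp
    fix q assume q: "q \<in> M"
    have "((\<lambda>i. c i * of_real q powr (-s)) has_sum a q * of_real q powr (-s)) (A q)"
      unfolding a_def by (rule has_sum_cmult_left[OF has_sum_infsum[OF abs_summable_summable[OF c_abs[OF q]]]])
    then show "((\<lambda>y. case (q, y) of (q, i) \<Rightarrow> c i * of_real (lam i) powr (-s)) has_sum a q * of_real q powr (-s)) (A q)"
      by (rule has_sum_cong[THEN iffD1, rotated]) (auto simp: A_def)
  qed
  ultimately show ?thesis using S(2) has_sum_infsum[OF sm]
    unfolding gds_def gds_coeffs_def
    by (intro exI[of _ a] conjI exI[of _ "infsum (\<lambda>q. cmod (a q) * q powr (-\<sigma>)) M"]) auto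
qed

section \<open>Algebra operations: monomials, products, powers, sums and power series\<close>

lemma gds_monomial:
  assumes "q \<in> M" "M \<subseteq> {1..}" "cmod c * q powr (-\<sigma>) \<le> B"
  shows "gds M \<sigma> B (\<lambda>s. c * of_real q powr (-s))"
  by (rule gds_of_family[where I="{()}" and lam="\<lambda>_. q" and c="\<lambda>_. c"])
     (use assms in \<open>auto intro: has_sum_finiteI\<close>)

text \<open>The product expands over \<open>M \<times> M\<close>, with \<open>a x * b y\<close> at
  frequency \<open>x * y\<close>, and the weights multiply as well. \<open>gds_of_family\<close>
  collects equal products, so the convolution of the coefficients is never written out.\<close>

lemma gds_mult:
  assumes f: "gds M \<sigma> B f" and g: "gds M \<sigma> C g"
    and M: "M \<subseteq> {1..}" "\<And>x y. x \<in> M \<Longrightarrow> y \<in> M \<Longrightarrow> x * y \<in> M"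
  shows "gds M \<sigma> (B * C) (\<lambda>s. f s * g s)"
proof -
  obtain a T where a: "T \<le> B" "((\<lambda>q. cmod (a q) * q powr (-\<sigma>)) has_sum T) M"
     "\<And>s. Re s \<ge> \<sigma> \<Longrightarrow> ((\<lambda>q. a q * of_real q powr (-s)) has_sum f s) M"
    using f unfolding gds_def gds_coeffs_def by blast
  obtain b U where b: "U \<le> C" "((\<lambda>q. cmod (b q) * q powr (-\<sigma>)) has_sum U) M"
     "\<And>s. Re s \<ge> \<sigma> \<Longrightarrow> ((\<lambda>q. b q * of_real q powr (-s)) has_sum g s) M"
    using g unfolding gds_def gds_coeffs_def by blast
  have pos: "q \<ge> 1" if "q \<in> M" for q using that M by auto
  let ?c = "\<lambda>(x,y). a x * b y" and ?l = "\<lambda>(x,y). x * y"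
  have U: "U \<ge> 0" by (rule has_sum_nonneg[OF b(2)]) auto
  have N: "((\<lambda>(x,y). (cmod (a x) * x powr (-\<sigma>)) * (cmod (b y) * y powr (-\<sigma>))) has_sum T * U) (M \<times> M)"
  proof (rule has_sum_SigmaI)
    show "((\<lambda>y. case (x, y) of (x,y) \<Rightarrow> (cmod (a x) * x powr (-\<sigma>)) * (cmod (b y) * y powr (-\<sigma>)))
             has_sum (cmod (a x) * x powr (-\<sigma>)) * U) M" for x
      using has_sum_cmult_right[OF b(2)] by simp
    show "((\<lambda>x. (cmod (a x) * x powr (-\<sigma>)) * U) has_sum T * U) M"
      using has_sum_cmult_left[OF a(2)] by simp
    then show "(\<lambda>(x,y). (cmod (a x) * x powr (-\<sigma>)) * (cmod (b y) * y powr (-\<sigma>))) summable_on (M \<times> M)"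
      using has_sum_cmult_right[OF b(2)]
      by (intro summable_on_SigmaI[where g="\<lambda>x. (cmod (a x) * x powr (-\<sigma>)) * U"]) (auto intro: has_sum_imp_summable)
  qed
  show ?thesis
  proof (rule gds_of_family[where I="M\<times>M" and c="?c" and lam="?l"])
    show "((\<lambda>i. cmod (?c i) * ?l i powr (-\<sigma>)) has_sum T * U) (M \<times> M)"
      by (rule has_sum_cong[THEN iffD1, OF _ N]) (auto simp: norm_mult powr_mult dest!: pos)
    show "T * U \<le> B * C"
      using a(1) b(1) U gds_nonneg[OF f] by (intro mult_mono) auto
    fix s assume s: "Re s \<ge> \<sigma>"
    have eq: "of_real (x * y) powr (-s) = complex_of_real x powr (-s) * of_real y powr (-s)"
      if "x \<in> M" "y \<in> M" for x y
      using pos[OF that(1)] pos[OF that(2)] by (simp add: powr_times_real)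
    have "((\<lambda>(x,y). (a x * of_real x powr (-s)) * (b y * of_real y powr (-s))) has_sum f s * g s) (M \<times> M)"
    proof (rule has_sum_SigmaI)
      show "((\<lambda>y. case (x, y) of (x,y) \<Rightarrow> (a x * of_real x powr (-s)) * (b y * of_real y powr (-s)))
             has_sum (a x * of_real x powr (-s)) * g s) M" for x
        using has_sum_cmult_right[OF b(3)[OF s]] by simp
      show "((\<lambda>x. (a x * of_real x powr (-s)) * g s) has_sum f s * g s) M"
        using has_sum_cmult_left[OF a(3)[OF s]] by simp
      have "cmod (case p of (x,y) \<Rightarrow> (a x * of_real x powr (-s)) * (b y * of_real y powr (-s)))
         \<le> (case p of (x,y) \<Rightarrow> (cmod (a x) * x powr (-\<sigma>)) * (cmod (b y) * y powr (-\<sigma>)))"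
        if p: "p \<in> M \<times> M" for p
      proof -
        obtain x y where xy: "p = (x,y)" "x \<ge> 1" "y \<ge> 1" using p pos by auto
        show ?thesis using xy s
          by (auto simp: norm_mult norm_powr_neg intro!: mult_mono powr_mono)
      qed
      then show "(\<lambda>(x,y). (a x * of_real x powr (-s)) * (b y * of_real y powr (-s))) summable_on (M \<times> M)"
        by (rule abs_summable_summable[OF summable_on_comparison_test[OF has_sum_imp_summable[OF N]]]) auto
    qed
    then show "((\<lambda>i. ?c i * of_real (?l i) powr (-s)) has_sum f s * g s) (M \<times> M)"
      by (rule has_sum_cong[THEN iffD1, rotated]) (auto simp: eq[simplified])
  qed (use M in auto)
qed

lemma gds_power:
  assumes f: "gds M \<sigma> B f"
    and M: "M \<subseteq> {1..}" "1 \<in> M" "\<And>x y. x \<in> M \<Longrightarrow> y \<in> M \<Longrightarrow> x * y \<in> M"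
  shows "gds M \<sigma> (B ^ j) (\<lambda>s. f s ^ j)"
proof (induction j)
  case 0
  have "gds M \<sigma> 1 (\<lambda>s. 1 * of_real 1 powr (-s))"
    by (rule gds_monomial) (use M in auto)
  then show ?case by simp
next
  case (Suc j)
  show ?case using gds_mult[OF f Suc.IH M(1,3)] by simp
qed

text \<open>The expansions for all \<open>j\<close> merge into one family over
  \<open>UNIV \<times> M\<close>, whose total norm is dominated by \<open>suminf B\<close>.\<close>

lemma gds_suminf:
  assumes f: "\<And>j::nat. gds M \<sigma> (B j) (f j)" and B: "summable B" and M: "M \<subseteq> {1..}"
  shows "gds M \<sigma> (\<Sum>j. B j) (\<lambda>s. \<Sum>j. f j s)"
proof -
  \<comment> \<open>Bundling coefficients and norm in one predicate lets a single choice over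
    \<open>j\<close> supply both.\<close>
  define P where "P j a T \<longleftrightarrow> T \<le> B j \<and> ((\<lambda>q. cmod (a q) * q powr (-\<sigma>)) has_sum T) M \<and>
     (\<forall>s. Re s \<ge> \<sigma> \<longrightarrow> ((\<lambda>q. a q * of_real q powr (-s)) has_sum f j s) M)" for j a T
  have "\<forall>j. \<exists>a T. P j a T"
    using f unfolding gds_def gds_coeffs_def P_def by blast
  then obtain a T where "\<And>j. P j (a j) (T j)" by metis
  then have a: "\<And>j. T j \<le> B j" "\<And>j. ((\<lambda>q. cmod (a j q) * q powr (-\<sigma>)) has_sum T j) M"
     "\<And>j s. Re s \<ge> \<sigma> \<Longrightarrow> ((\<lambda>q. a j q * of_real q powr (-s)) has_sum f j s) M"
    unfolding P_def by auto
  have T0: "T j \<ge> 0" for j by (rule has_sum_nonneg[OF a(2)]) auto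
  have pos: "q \<ge> 1" if "q \<in> M" for q using that M by auto
  have Ts: "summable T" by (rule summable_comparison_test'[OF B]) (use a T0 in auto)
  have Th: "(T has_sum suminf T) UNIV"
    by (rule norm_summable_imp_has_sum) (use Ts T0 in \<open>auto simp: summable_sums\<close>)
  have sm: "(\<lambda>(j,q). cmod (a j q) * q powr (-\<sigma>)) summable_on (UNIV \<times> M)"
    by (rule summable_on_SigmaI[where g=T]) (use a(2) Th has_sum_imp_summable in auto)
  have N: "((\<lambda>(j,q). cmod (a j q) * q powr (-\<sigma>)) has_sum suminf T) (UNIV \<times> M)"
    by (rule has_sum_SigmaI[OF _ Th sm]) (use a(2) in auto)
  show ?thesis
  proof (rule gds_of_family[where I="UNIV\<times>M" and c="\<lambda>(j,q). a j q" and lam=snd])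
    show "((\<lambda>i. cmod (case i of (j, q) \<Rightarrow> a j q) * snd i powr - \<sigma>) has_sum suminf T) (UNIV \<times> M)"
      using N by (simp add: case_prod_unfold)
    show "suminf T \<le> suminf B" by (rule suminf_le[OF a(1) Ts B])
    fix s assume s: "Re s \<ge> \<sigma>"
    have sm': "(\<lambda>i. (case i of (j, q) \<Rightarrow> a j q) * complex_of_real (snd i) powr - s) summable_on (UNIV \<times> M)"
    proof (rule abs_summable_summable[OF summable_on_comparison_test[OF sm]])
      fix x assume "x \<in> (UNIV :: nat set) \<times> M"
      then obtain j q where "x = (j,q)" "q \<ge> 1" using pos by auto
      then show "cmod ((case x of (j, q) \<Rightarrow> a j q) * complex_of_real (snd x) powr - s) \<le> (case x of (j, q) \<Rightarrow> cmod (a j q) * q powr - \<sigma>)"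
        using s by (auto simp: norm_mult norm_powr_neg intro!: mult_left_mono powr_mono)
    qed auto
    have fT: "cmod (f j s) \<le> T j" for j
      by (rule norm_le_weighted_sum[OF M s a(2) a(3)[OF s]])
    have "((\<lambda>j. f j s) has_sum (\<Sum>j. f j s)) UNIV"
    proof (rule norm_summable_imp_has_sum)
      show "summable (\<lambda>j. cmod (f j s))" by (rule summable_comparison_test'[OF Ts]) (use fT in auto)
      then show "(\<lambda>j. f j s) sums (\<Sum>j. f j s)" by (rule summable_sums[OF summable_norm_cancel])
    qed
    then show "((\<lambda>i. (case i of (j, q) \<Rightarrow> a j q) * complex_of_real (snd i) powr - s) has_sum (\<Sum>j. f j s)) (UNIV \<times> M)"
      by (rule has_sum_SigmaI[OF _ _ sm', rotated]) (use a(3)[OF s] in auto)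
  qed (use M in auto)
qed

text \<open>Absolute convergence at radius \<open>B\<close> is what the algebra norm asks for. The
  instances are the exponential, the logarithm and a Taylor expansion.\<close>

lemma gds_power_series:
  assumes w: "gds M \<sigma> B w" and c: "summable (\<lambda>j. cmod (c j) * B ^ j)"
    and M: "M \<subseteq> {1..}" "1 \<in> M" "\<And>x y. x \<in> M \<Longrightarrow> y \<in> M \<Longrightarrow> x * y \<in> M"
  shows "gds M \<sigma> (\<Sum>j. cmod (c j) * B ^ j) (\<lambda>s. \<Sum>j. c j * w s ^ j)"
proof (rule gds_suminf[OF _ c M(1)])
  fix j
  have "gds M \<sigma> (cmod (c j)) (\<lambda>s. c j * of_real 1 powr (-s))"
    by (rule gds_monomial) (use M in auto)
  then have "gds M \<sigma> (cmod (c j)) (\<lambda>s. c j)" by simp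
  from gds_mult[OF this gds_power[OF w M] M(1,3)]
  show "gds M \<sigma> (cmod (c j) * B ^ j) (\<lambda>s. c j * w s ^ j)" .
qed

text \<open>Every frequency is at least \<open>\<delta>\<close>, so moving the abscissa to the right
  gains the factor \<open>\<delta> powr (\<sigma> - \<sigma>')\<close> in each weight. For
  \<open>\<delta> = 1\<close> this merely shrinks the half-plane; \<open>\<delta> > 1\<close> is the
  source of all smallness far to the right.\<close>

lemma gds_shift:
  assumes w: "gds M \<sigma> B w" and M: "M \<subseteq> {\<delta>..}" "\<delta> \<ge> 1" and \<sigma>': "\<sigma>' \<ge> \<sigma>"
  shows "gds M \<sigma>' (B * \<delta> powr (\<sigma> - \<sigma>')) w"
proof -
  obtain a T where a: "T \<le> B" "((\<lambda>q. cmod (a q) * q powr (-\<sigma>)) has_sum T) M"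
     "\<And>s. Re s \<ge> \<sigma> \<Longrightarrow> ((\<lambda>q. a q * of_real q powr (-s)) has_sum w s) M"
    using w unfolding gds_def gds_coeffs_def by blast
  have T': "((\<lambda>q. cmod (a q) * q powr (-\<sigma>) * \<delta> powr (\<sigma> - \<sigma>')) has_sum T * \<delta> powr (\<sigma> - \<sigma>')) M"
    by (rule has_sum_cmult_left[OF a(2)])
  have le: "cmod (a q) * q powr (-\<sigma>') \<le> cmod (a q) * q powr (-\<sigma>) * \<delta> powr (\<sigma> - \<sigma>')" if "q \<in> M" for q
  proof -
    have q: "q \<ge> \<delta>" using that M by auto
    have "q powr (-\<sigma>') = q powr (-\<sigma>) * q powr (\<sigma> - \<sigma>')"
      by (simp add: powr_add[symmetric])
    also have "\<dots> \<le> q powr (-\<sigma>) * \<delta> powr (\<sigma> - \<sigma>')"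
      using q M(2) \<sigma>' by (intro mult_left_mono powr_mono2') auto
    finally show ?thesis by (simp add: mult.assoc mult_left_mono)
  qed
  have sm: "(\<lambda>q. cmod (a q) * q powr (-\<sigma>')) summable_on M"
    by (rule summable_on_comparison_test[OF has_sum_imp_summable[OF T']]) (use le in auto)
  have "infsum (\<lambda>q. cmod (a q) * q powr (-\<sigma>')) M \<le> T * \<delta> powr (\<sigma> - \<sigma>')"
    by (rule has_sum_mono[OF has_sum_infsum[OF sm] T']) (use le in auto)
  also have "\<dots> \<le> B * \<delta> powr (\<sigma> - \<sigma>')" using a(1) by (intro mult_right_mono) auto
  finally show ?thesis using has_sum_infsum[OF sm] a(3) \<sigma>'
    unfolding gds_def gds_coeffs_def
    by (intro exI[of _ a] conjI exI[of _ "infsum (\<lambda>q. cmod (a q) * q powr (-\<sigma>')) M"]) auto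
qed

lemma gds_eventually_small:
  assumes w: "gds M \<sigma> B w" and M: "M \<subseteq> {\<delta>..}" "\<delta> > 1" and \<epsilon>: "\<epsilon> > 0"
  shows "\<forall>\<^sub>F \<sigma>' in at_top. gds M \<sigma>' \<epsilon> w"
proof -
  have "((\<lambda>x. B * \<delta> powr (\<sigma> - x)) \<longlongrightarrow> 0) at_top"
    using M(2) by real_asymp
  then have "\<forall>\<^sub>F x in at_top. B * \<delta> powr (\<sigma> - x) < \<epsilon>"
    using \<epsilon> by (rule order_tendstoD(2))
  then show ?thesis using eventually_ge_at_top[of \<sigma>]
  proof eventually_elim
    case (elim x)
    then show ?case using gds_mono[OF gds_shift[OF w M(1), of x] order_refl, of \<epsilon>] M(2) by auto
  qed
qed

subsection \<open>Leading terms and uniqueness\<close>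

text \<open>Local finiteness provides a least frequency \<open>q0\<close> with nonzero coefficient
  and a gap above it. Factoring out \<open>q0\<close> leaves a nonzero constant plus a series with
  frequencies at least \<open>\<delta> > 1\<close>, which becomes small far to the right.\<close>

lemma gds_leading:
  assumes g: "gds_coeffs L \<sigma> B a g"
    and L: "L \<subseteq> {1..}" "\<And>X. finite (L \<inter> {..X})" and nz: "\<exists>q\<in>L. a q \<noteq> 0"
  obtains q0 \<delta> B' w where "q0 \<in> L" "a q0 \<noteq> 0" "\<delta> > 1"
    "gds ((\<lambda>q. q / q0) ` L \<inter> {\<delta>..}) \<sigma> B' w"
    "\<And>s. Re s \<ge> \<sigma> \<Longrightarrow> g s = of_real q0 powr (-s) * (a q0 + w s)"
proof -
  obtain T where a: "((\<lambda>q. cmod (a q) * q powr (-\<sigma>)) has_sum T) L"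
     "\<And>s. Re s \<ge> \<sigma> \<Longrightarrow> ((\<lambda>q. a q * of_real q powr (-s)) has_sum g s) L"
    using g unfolding gds_coeffs_def by blast
  define S where "S = {q\<in>L. a q \<noteq> 0}"
  obtain p where p: "p \<in> S" using nz by (auto simp: S_def)
  have fin: "finite (S \<inter> {..p})" by (rule finite_subset[OF _ L(2)[of p]]) (auto simp: S_def)
  \<comment> \<open>Cutting off at the known element \<open>p\<close> makes the minimum range over a
    finite set.\<close>
  define q0 where "q0 = Min (S \<inter> {..p})"
  have "q0 \<in> S \<inter> {..p}" unfolding q0_def by (rule Min_in[OF fin]) (use p in auto)
  then have q0: "q0 \<in> S" "q0 \<le> p" by auto
  have q0_le: "q0 \<le> q" if "q \<in> S" for q
  proof (cases "q \<le> p")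
    case True
    then show ?thesis unfolding q0_def using that fin by (intro Min_le) auto
  qed (use q0 in auto)
  have q01: "q0 \<ge> 1" using q0 L(1) by (auto simp: S_def)
  \<comment> \<open>A lower bound \<open>q1\<close> for the frequencies beyond \<open>q0\<close>.
    Inserting \<open>q0 + 1\<close> keeps the set nonempty even if no frequency follows
    nearby.\<close>
  define F where "F = insert (q0 + 1) (L \<inter> {..q0+1} \<inter> {q0<..})"
  have finF: "finite F" using L(2)[of "q0+1"] by (auto simp: F_def)
  define q1 where "q1 = Min F"
  have "q1 \<in> F" unfolding q1_def by (rule Min_in[OF finF]) (auto simp: F_def)
  then have q1: "q1 > q0" by (auto simp: F_def)
  have q1_le: "q1 \<le> q" if "q \<in> L" "q > q0" for q
  proof (cases "q \<le> q0 + 1")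
    case True
    then show ?thesis unfolding q1_def using that finF by (intro Min_le) (auto simp: F_def)
  next
    case False
    have "q1 \<le> q0 + 1" unfolding q1_def using finF by (intro Min_le) (auto simp: F_def)
    then show ?thesis using False by simp
  qed
  define w where "w s = g s * of_real q0 powr s - a q0" for s
  \<comment> \<open>Terms with zero coefficient are dropped, so every remaining frequency exceeds
    \<open>q0\<close> and is therefore at least \<open>q1\<close>.\<close>
  let ?I = "S - {q0}"
  have inv: "of_real q0 powr (-s) * of_real q0 powr s = (1::complex)" for s
    using q01 by (simp add: powr_minus)
  have pos: "q > 0" if "q \<in> L" for q using that L(1) by force
  have aI: "(\<lambda>q. cmod (a q) * q powr (-\<sigma>)) summable_on ?I"
    by (rule summable_on_subset_banach[OF has_sum_imp_summable[OF a(1)]]) (auto simp: S_def)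
  have "gds ((\<lambda>q. q / q0) ` L \<inter> {q1/q0..}) \<sigma> (infsum (\<lambda>q. cmod (a q) * q powr (-\<sigma>)) ?I * q0 powr \<sigma>) w"
  proof (rule gds_of_family[where I="?I" and lam="\<lambda>q. q / q0" and c=a])
    show "q / q0 \<in> (\<lambda>q. q / q0) ` L \<inter> {q1 / q0..}" if "q \<in> ?I" for q
      using that q0_le[of q] q1_le[of q] q01 by (auto simp: S_def divide_right_mono)
    show "(\<lambda>q. q / q0) ` L \<inter> {q1 / q0..} \<subseteq> {1..}" using q1 q01 by (auto intro: order_trans[of _ "q1/q0"])
    have "((\<lambda>q. cmod (a q) * q powr (-\<sigma>) * q0 powr \<sigma>) has_sum infsum (\<lambda>q. cmod (a q) * q powr (-\<sigma>)) ?I * q0 powr \<sigma>) ?I"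
      by (rule has_sum_cmult_left[OF has_sum_infsum[OF aI]])
    moreover have "cmod (a q) * q powr (-\<sigma>) * q0 powr \<sigma> = cmod (a q) * (q / q0) powr (-\<sigma>)" if "q \<in> ?I" for q
      using q01 pos[of q] that by (auto simp: S_def powr_divide powr_minus field_simps)
    ultimately show "((\<lambda>q. cmod (a q) * (q / q0) powr - \<sigma>) has_sum infsum (\<lambda>q. cmod (a q) * q powr (-\<sigma>)) ?I * q0 powr \<sigma>) ?I"
      by (rule has_sum_cong[THEN iffD1, rotated])
  next
    fix s assume s: "Re s \<ge> \<sigma>"
    have "((\<lambda>q. a q * of_real q powr (-s)) has_sum g s) S"
      using a(2)[OF s] by (rule has_sum_cong_neutral[THEN iffD1, rotated -1]) (auto simp: S_def)
    then have "((\<lambda>q. a q * of_real q powr (-s)) has_sum (g s - a q0 * of_real q0 powr (-s))) ?I"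
      by (rule has_sum_Diff) (use q0 in \<open>auto intro: has_sum_finiteI\<close>)
    then have h1: "((\<lambda>q. a q * of_real q powr (-s) * of_real q0 powr s) has_sum (g s - a q0 * of_real q0 powr (-s)) * of_real q0 powr s) ?I"
      by (rule has_sum_cmult_left)
    have h2: "(g s - a q0 * of_real q0 powr (-s)) * of_real q0 powr s = w s"
      unfolding w_def using inv[of s] by (simp add: algebra_simps)
    have h3: "a q * of_real q powr (-s) * of_real q0 powr s = a q * of_real (q / q0) powr (-s)" if "q \<in> ?I" for q
    proof -
      have qp: "q > 0" using pos[of q] that by (auto simp: S_def)
      have "complex_of_real q powr (-s) = of_real ((q / q0) * q0) powr (-s)" using q01 by simp
      also have "\<dots> = of_real (q / q0) powr (-s) * of_real q0 powr (-s)"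
        using qp q01 by (subst of_real_mult, subst powr_times_real) auto
      finally show ?thesis using inv[of s] by (simp add: algebra_simps)
    qed
    show "((\<lambda>q. a q * of_real (q / q0) powr (-s)) has_sum w s) ?I"
      using has_sum_cong[THEN iffD1, OF h3 h1] unfolding h2 .
  qed auto
  moreover have "g s = of_real q0 powr (-s) * (a q0 + w s)" for s
    unfolding w_def using inv[of s] by (simp add: algebra_simps)
  moreover have "q1 / q0 > 1" using q1 q01 by simp
  ultimately show ?thesis using that[of q0 "q1/q0"] q0 by (auto simp: S_def)
qed

text \<open>A nonzero coefficient would produce a leading term. Vanishing of the sum then forces
  \<open>w = - a q0\<close>, while far to the right \<open>w\<close> has norm at most
  \<open>cmod (a q0) / 2\<close>.\<close>

lemma gds_coeffs_unique:
  assumes g: "gds_coeffs L \<sigma> B a (\<lambda>s. 0)"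
    and L: "L \<subseteq> {1..}" "\<And>X. finite (L \<inter> {..X})" and q: "q \<in> L"
  shows "a q = 0"
proof (rule ccontr)
  assume "a q \<noteq> 0"
  then have "\<exists>q\<in>L. a q \<noteq> 0" using q by blast
  from gds_leading[OF g L this] obtain q0 \<delta> B' w where w: "q0 \<in> L" "a q0 \<noteq> 0" "\<delta> > 1"
    "gds ((\<lambda>q. q / q0) ` L \<inter> {\<delta>..}) \<sigma> B' w"
    "\<And>s. Re s \<ge> \<sigma> \<Longrightarrow> 0 = of_real q0 powr (-s) * (a q0 + w s)" by blast
  let ?M = "(\<lambda>q. q / q0) ` L \<inter> {\<delta>..}"
  have "\<forall>\<^sub>F x in at_top. gds ?M x (cmod (a q0) / 2) w"
    by (rule gds_eventually_small[OF w(4) _ w(3)]) (use w(2) in auto)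
  then have "\<forall>\<^sub>F x in at_top. gds ?M x (cmod (a q0) / 2) w \<and> x \<ge> \<sigma>"
    using eventually_ge_at_top by (rule eventually_conj)
  then obtain x where x: "gds ?M x (cmod (a q0) / 2) w" "x \<ge> \<sigma>"
    using eventually_happens'[OF trivial_limit_at_top_linorder] by blast
  have "cmod (w (of_real x)) \<le> cmod (a q0) / 2"
    by (rule gds_bound[OF x(1)]) (use w(3) in auto)
  moreover have "w (of_real x) = - a q0"
    using w(5)[of "of_real x"] x(2) w(1) L(1) by (auto simp: add_eq_0_iff)
  ultimately show False using w(2) by simp
qed

subsection \<open>Ordinary Dirichlet series\<close>

definition Npos :: "real set" where "Npos = real ` {1..}"

lemma Npos_ge_1: "Npos \<subseteq> {1..}" by (auto simp: Npos_def)

lemma Npos_mult: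
  assumes "x \<in> Npos" "y \<in> Npos"
  shows "x * y \<in> Npos"
proof -
  obtain m n where "x = real m" "y = real n" "m \<ge> 1" "n \<ge> 1"
    using assms by (auto simp: Npos_def)
  then show ?thesis unfolding Npos_def by (intro image_eqI[of _ _ "m * n"]) auto
qed

lemma one_Npos: "1 \<in> Npos" by (auto simp: Npos_def image_iff intro!: bexI[of _ 1])

lemma Npos_locally_finite: "finite (Npos \<inter> {..X})"
proof -
  have "Npos \<inter> {..X} \<subseteq> real ` {..nat \<lceil>X\<rceil>}"
    by (auto simp: Npos_def intro!: imageI) linarith
  then show ?thesis by (rule finite_subset) simp
qed

lemma bij_Npos: "bij_betw (\<lambda>n. real (Suc n)) UNIV Npos"
proof -
  have "range (\<lambda>n. real (Suc n)) = Npos"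
  proof
    show "Npos \<subseteq> range (\<lambda>n. real (Suc n))"
    proof
      fix x assume "x \<in> Npos"
      then obtain n where "x = real n" "n \<ge> 1" by (auto simp: Npos_def)
      then have "x = real (Suc (n - 1))" by simp
      then show "x \<in> range (\<lambda>n. real (Suc n))" by blast
    qed
  qed (auto simp: Npos_def simp del: of_nat_Suc)
  then show ?thesis by (simp add: bij_betw_def inj_on_def)
qed

lemma dir_term_eq: "dir_term a s n = a (Suc n) * of_real (real (Suc n)) powr (-s)"
  unfolding dir_term_def by (simp add: powr_minus_divide del: of_nat_Suc)

text \<open>Convergence at one real point bounds the terms there, and moving 2 units further right
  turns this bound into a multiple of \<open>n powr (-2)\<close>. Absolute convergence thus costs
  only a shift of the abscissa.\<close>

lemma in_D_imp_gds:
  assumes "in_D \<theta> g"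
  obtains \<sigma> B a where "\<sigma> > \<theta>" "gds_coeffs Npos \<sigma> B a g"
proof -
  obtain a \<sigma>0 where "\<forall>s \<in> half_plane \<sigma>0. summable (dir_term a s)"
      "\<forall>s \<in> half_plane \<sigma>0 \<inter> half_plane \<theta>. dir_term a s sums g s"
    using assms unfolding in_D_def by (elim exE conjE)
  then have a: "\<And>s. s \<in> half_plane \<sigma>0 \<Longrightarrow> summable (dir_term a s)"
      "\<And>s. s \<in> half_plane \<sigma>0 \<inter> half_plane \<theta> \<Longrightarrow> dir_term a s sums g s"
    by simp_all
  \<comment> \<open>This point lies strictly inside both the half-plane of convergence and the
    domain of \<open>g\<close>.\<close>
  define \<sigma>1 where "\<sigma>1 = max \<sigma>0 \<theta> + 1"
  have "summable (dir_term a (of_real \<sigma>1))"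
    by (rule a(1)) (auto simp: half_plane_def \<sigma>1_def)
  then have "Bseq (dir_term a (of_real \<sigma>1))"
    by (intro convergent_imp_Bseq) (auto simp: convergent_def dest!: summable_LIMSEQ_zero)
  then obtain K where K: "\<And>n. cmod (dir_term a (of_real \<sigma>1) n) \<le> K"
    by (auto simp: Bseq_def)
  have K': "cmod (a (Suc n)) * real (Suc n) powr (-\<sigma>1) \<le> K" for n
    using K[of n] by (simp add: dir_term_eq norm_mult norm_powr_neg del: of_nat_Suc of_real_of_nat_eq)
  have le: "cmod (a (Suc n)) * real (Suc n) powr (-(\<sigma>1 + 2)) \<le> K * real (Suc n) powr (-2)" for n
  proof -
    have "cmod (a (Suc n)) * real (Suc n) powr (-(\<sigma>1 + 2)) = cmod (a (Suc n)) * real (Suc n) powr (-\<sigma>1) * real (Suc n) powr (-2)"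
      by (simp add: powr_add[symmetric] mult.assoc del: of_nat_Suc)
    also have "\<dots> \<le> K * real (Suc n) powr (-2)" by (intro mult_right_mono K') auto
    finally show ?thesis .
  qed
  have sm2: "summable (\<lambda>n. K * real (Suc n) powr (-2))"
    by (intro summable_mult, subst summable_Suc_iff) (simp add: summable_real_powr_iff)
  have sm: "summable (\<lambda>n. cmod (a (Suc n)) * real (Suc n) powr (-(\<sigma>1 + 2)))"
    by (rule summable_comparison_test'[OF sm2]) (use le in auto)
  \<comment> \<open>Coefficients are reindexed by real frequencies; only the values on
    \<open>Npos\<close> matter.\<close>
  define A where "A q = a (nat \<lfloor>q\<rfloor>)" for q :: real
  have "((\<lambda>n. cmod (a (Suc n)) * real (Suc n) powr (-(\<sigma>1 + 2))) has_sum suminf (\<lambda>n. cmod (a (Suc n)) * real (Suc n) powr (-(\<sigma>1 + 2)))) UNIV"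
    by (rule norm_summable_imp_has_sum) (use sm in \<open>auto simp: abs_mult summable_sums simp del: of_nat_Suc\<close>)
  then have 1: "((\<lambda>q. cmod (A q) * q powr (-(\<sigma>1 + 2))) has_sum suminf (\<lambda>n. cmod (a (Suc n)) * real (Suc n) powr (-(\<sigma>1 + 2)))) Npos"
    by (subst has_sum_reindex_bij_betw[OF bij_Npos, symmetric]) (simp add: A_def del: of_nat_Suc)
  have 2: "((\<lambda>q. A q * of_real q powr (-s)) has_sum g s) Npos" if s: "Re s \<ge> \<sigma>1 + 2" for s
  proof -
    have "(dir_term a s has_sum g s) UNIV"
    proof (rule norm_summable_imp_has_sum)
      show "summable (\<lambda>n. cmod (dir_term a s n))"
        by (rule summable_comparison_test'[OF sm])
           (use norm_term_le[OF _ s] in \<open>auto simp: dir_term_eq simp del: of_nat_Suc of_real_of_nat_eq\<close>)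
      show "dir_term a s sums g s"
        by (rule a(2)) (use s in \<open>auto simp: half_plane_def \<sigma>1_def\<close>)
    qed
    then show ?thesis
      by (subst has_sum_reindex_bij_betw[OF bij_Npos, symmetric]) (simp add: A_def dir_term_eq[abs_def] del: of_nat_Suc of_real_of_nat_eq)
  qed
  show ?thesis
    by (rule that[of "\<sigma>1 + 2" "suminf (\<lambda>n. cmod (a (Suc n)) * real (Suc n) powr (-(\<sigma>1 + 2)))" A])
       (use 1 2 in \<open>auto simp: gds_coeffs_def \<sigma>1_def\<close>)
qed

lemma gds_imp_in_D:
  assumes "gds Npos \<sigma> B h" "\<And>s. Re s > \<sigma> \<Longrightarrow> Re s > \<theta> \<Longrightarrow> h s = g s"
  shows "in_D \<theta> g"
proof -
  obtain a where a: "\<And>s. Re s \<ge> \<sigma> \<Longrightarrow> ((\<lambda>q. a q * of_real q powr (-s)) has_sum h s) Npos"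
    using assms(1) unfolding gds_def gds_coeffs_def by blast
  have "dir_term (\<lambda>n. a (real n)) s sums h s" if "Re s > \<sigma>" for s
  proof -
    have "((\<lambda>n. a (real (Suc n)) * of_real (real (Suc n)) powr (-s)) has_sum h s) UNIV"
      using a[of s] that by (subst has_sum_reindex_bij_betw[OF bij_Npos]) auto
    then show ?thesis unfolding dir_term_eq[abs_def] by (rule has_sum_imp_sums)
  qed
  then show ?thesis unfolding in_D_def using assms(2)
    by (intro exI[of _ "\<lambda>n. a (real n)"] exI[of _ \<sigma>]) (auto simp: half_plane_def sums_iff)
qed

subsection \<open>Exponents with integral powers\<close>

text \<open>The recursion differences the function before taking the remaining differences, so that
  an induction can pass from a function to its first difference.\<close>

primrec fwd_diff :: "nat \<Rightarrow> (real \<Rightarrow> real) \<Rightarrow> real \<Rightarrow> real" where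
  "fwd_diff 0 f x = f x"
| "fwd_diff (Suc k) f x = fwd_diff k (\<lambda>y. f (y + 1) - f y) x"

text \<open>The mean value theorem for higher differences, with \<open>F\<close> a chain of
  successive derivatives. The first differences \<open>G\<close> form such a chain again; the
  induction hypothesis for \<open>G\<close> leaves a single first difference of \<open>F k\<close>,
  to which the usual mean value theorem applies.\<close>

lemma fwd_diff_mvt:
  assumes "\<And>i x. x > 0 \<Longrightarrow> (F i has_real_derivative F (Suc i) x) (at x)" and "x > 0"
  shows "\<exists>\<xi>\<ge>x. fwd_diff k (F 0) x = F k \<xi>"
  using assms(1)
proof (induction k arbitrary: F)
  case 0
  then show ?case by auto
next
  case (Suc k)
  define G where "G i y = F i (y + 1) - F i y" for i y
  have "(G i has_real_derivative G (Suc i) y) (at y)" if "y > 0" for i y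
  proof -
    have "((\<lambda>y. F i (y + 1)) has_real_derivative F (Suc i) (y + 1)) (at y)"
      using Suc.prems[of "y+1" i] that by (simp add: DERIV_shift)
    then show ?thesis unfolding G_def by (intro DERIV_diff Suc.prems that)
  qed
  from Suc.IH[of G, OF this] obtain \<eta> where \<eta>: "\<eta> \<ge> x" "fwd_diff k (G 0) x = G k \<eta>" by blast
  obtain \<xi> where \<xi>: "\<xi> > \<eta>" "F k (\<eta> + 1) - F k \<eta> = (\<eta> + 1 - \<eta>) * F (Suc k) \<xi>"
    using MVT2[of \<eta> "\<eta> + 1" "F k" "F (Suc k)"] Suc.prems \<eta>(1) \<open>x > 0\<close> by force
  have "fwd_diff (Suc k) (F 0) x = F (Suc k) \<xi>"
    using \<eta>(2) \<xi>(2) by (simp add: G_def[abs_def])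
  then show ?case using \<eta>(1) \<xi>(1) by (intro exI[of _ \<xi>]) auto
qed

lemma fwd_diff_Ints:
  assumes "\<And>n::nat. n \<ge> 1 \<Longrightarrow> f (real n) \<in> \<int>" and "n \<ge> 1"
  shows "fwd_diff k f (real n) \<in> \<int>"
  using assms(1)
proof (induction k arbitrary: f)
  case 0
  then show ?case using assms(2) by simp
next
  case (Suc k)
  have "f (real n + 1) - f (real n) \<in> \<int>" if "n \<ge> 1" for n :: nat
    using Suc.prems[of n] Suc.prems[of "Suc n"] that by (auto simp: add.commute)
  from Suc.IH[of "\<lambda>y. f (y + 1) - f y", OF this] show ?case by simp
qed

text \<open>If \<open>c\<close> is not a natural number, the \<open>k\<close>-th difference of \<open>x powr c\<close> for \<open>k > c\<close> equals a
  \<open>k\<close>-th derivative at a nearby point, so it is nonzero and tends to 0; but it is an integer.\<close>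

lemma nat_exponent_of_integral_powers:
  fixes c :: real
  assumes int: "\<And>n::nat. n \<ge> 1 \<Longrightarrow> real n powr c \<in> \<int>"
  shows "\<exists>k::nat. c = real k"
proof (rule ccontr)
  assume not: "\<not> ?thesis"
  \<comment> \<open>\<open>F i\<close> is the \<open>i\<close>-th derivative of
    \<open>x powr c\<close>, with the falling factorial of \<open>c\<close> in front.\<close>
  define F where "F i x = (\<Prod>j<i. c - real j) * x powr (c - real i)" for i x
  have der: "(F i has_real_derivative F (Suc i) x) (at x)" if "x > 0" for i x
    unfolding F_def using that
    by (auto intro!: derivative_eq_intros simp: algebra_simps)
  obtain k :: nat where k: "real k > c" using reals_Archimedean2 by blast
  define P where "P = \<bar>\<Prod>j<k. c - real j\<bar>"
  \<comment> \<open>No factor \<open>c - real j\<close> vanishes, precisely because \<open>c\<close>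
    is not a natural number.\<close>
  have P: "P > 0" using not by (auto simp: P_def)
  have "((\<lambda>n. P * real n powr (c - real k)) \<longlongrightarrow> 0) sequentially"
    using k by real_asymp
  then have "\<forall>\<^sub>F n in sequentially. P * real n powr (c - real k) < 1 \<and> n \<ge> 1"
    using eventually_ge_at_top[of 1] by (intro eventually_conj order_tendstoD(2)) auto
  then obtain n :: nat where n: "P * real n powr (c - real k) < 1" "n \<ge> 1"
    using eventually_happens'[OF sequentially_bot] by blast
  obtain \<xi> where \<xi>: "\<xi> \<ge> real n" "fwd_diff k (F 0) (real n) = F k \<xi>"
    using fwd_diff_mvt[of F "real n" k, OF der] n(2) by auto
  have "F k \<xi> \<in> \<int>"
    unfolding \<xi>(2)[symmetric] using int n(2) by (intro fwd_diff_Ints) (auto simp: F_def)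
  moreover have abs: "\<bar>F k \<xi>\<bar> = P * \<xi> powr (c - real k)"
    by (simp add: F_def P_def abs_mult)
  then have "F k \<xi> \<noteq> 0" using P \<xi>(1) n(2) by auto
  moreover have "\<bar>F k \<xi>\<bar> < 1"
  proof -
    have "\<xi> powr (c - real k) \<le> real n powr (c - real k)"
      using \<xi>(1) n(2) k by (intro powr_mono2') auto
    then show ?thesis using n(1) P abs by (smt (verit) mult_left_mono)
  qed
  ultimately show False using Ints_nonzero_abs_less1 by blast
qed

subsection \<open>The frequencies of a logarithm\<close>

text \<open>The frequencies of powers of \<open>\<Sum>k>m. a\<^sub>k (k/m)\<^bsup>-s\<^esup>\<close>: a \<open>j\<close>-fold product of
  such \<open>k/m\<close> is at least \<open>(1 + 1/m) ^ j\<close>. Recording this bound keeps the set locally finite,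
  whereas the set of all \<open>k / m ^ j\<close> is dense.\<close>

definition quot_monoid :: "nat \<Rightarrow> real set" where
  "quot_monoid m = {real k / real m ^ j | k j. (1 + 1 / real m) ^ j \<le> real k / real m ^ j}"

lemma quot_monoid_ge_1: "quot_monoid m \<subseteq> {1..}"
proof
  fix q assume "q \<in> quot_monoid m"
  then obtain j where "(1 + 1 / real m) ^ j \<le> q" by (auto simp: quot_monoid_def)
  moreover have "1 \<le> (1 + 1 / real m) ^ j" by (intro one_le_power) auto
  ultimately have "1 \<le> q" by linarith
  then show "q \<in> {1..}" by simp
qed

lemma one_quot_monoid: "1 \<in> quot_monoid m"
  unfolding quot_monoid_def by (rule CollectI, rule exI[of _ 1], rule exI[of _ 0]) simp

lemma quot_monoid_mult:
  assumes "x \<in> quot_monoid m" "y \<in> quot_monoid m"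
  shows "x * y \<in> quot_monoid m"
proof -
  obtain k j k' j' where *: "x = real k / real m ^ j" "(1 + 1 / real m) ^ j \<le> x"
    "y = real k' / real m ^ j'" "(1 + 1 / real m) ^ j' \<le> y"
    using assms by (auto simp: quot_monoid_def)
  have "(1 + 1 / real m) ^ (j + j') \<le> x * y"
    unfolding power_add using *(2,4) quot_monoid_ge_1[of m] assms
    by (intro mult_mono) (auto intro: order_trans[of 0 1])
  moreover have "x * y = real (k * k') / real m ^ (j + j')"
    using *(1,3) by (simp add: power_add)
  ultimately show ?thesis unfolding quot_monoid_def by (intro CollectI exI[of _ "k * k'"] exI[of _ "j + j'"]) simp
qed

text \<open>By Bernoulli's inequality, \<open>(1 + 1/m) ^ j \<le> X\<close> bounds \<open>j\<close>
  by \<open>m * X\<close>; with the denominator bounded, so is the numerator.\<close>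

lemma quot_monoid_locally_finite:
  assumes "m \<ge> 1"
  shows "finite (quot_monoid m \<inter> {..X})"
proof -
  define J where "J = nat \<lceil>real m * X\<rceil>"
  define K where "K = nat \<lceil>X * real m ^ J\<rceil>"
  have "quot_monoid m \<inter> {..X} \<subseteq> (\<lambda>(k,j). real k / real m ^ j) ` ({..K} \<times> {..J})"
  proof
    fix q assume q: "q \<in> quot_monoid m \<inter> {..X}"
    then obtain k j where kj: "q = real k / real m ^ j" "(1 + 1 / real m) ^ j \<le> q"
      by (auto simp: quot_monoid_def)
    have X: "q \<le> X" "X \<ge> 1" using q quot_monoid_ge_1[of m] by force+
    have "1 + real j * (1 / real m) \<le> (1 + 1 / real m) ^ j"
      by (rule Bernoulli_inequality) (use assms in \<open>auto simp: field_simps\<close>)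
    then have "real j * (1 / real m) \<le> X" using kj(2) X by linarith
    then have "real j \<le> real m * X" using assms by (simp add: field_simps)
    then have j: "j \<le> J" unfolding J_def by linarith
    have "real k = q * real m ^ j" using kj(1) assms by simp
    also have "\<dots> \<le> X * real m ^ J"
      using X j assms by (intro mult_mono power_increasing) auto
    finally have "k \<le> K" unfolding K_def by linarith
    then show "q \<in> (\<lambda>(k,j). real k / real m ^ j) ` ({..K} \<times> {..J})" using j kj(1) by auto
  qed
  then show ?thesis by (rule finite_subset) simp
qed

text \<open>Cross-multiplying two representations gives \<open>k * m' ^ j' = k' * m ^ j\<close>.
  Coprimality then makes \<open>m ^ j\<close> divide \<open>k\<close>, so the fraction is an
  integer.\<close>

lemma quot_monoid_Int_subset_Npos:
  assumes "coprime m m'" "m \<ge> 1" "m' \<ge> 1"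
  shows "quot_monoid m \<inter> quot_monoid m' \<subseteq> Npos"
proof
  fix q assume q: "q \<in> quot_monoid m \<inter> quot_monoid m'"
  obtain k j where k: "q = real k / real m ^ j" using q unfolding quot_monoid_def by blast
  obtain k' j' where k': "q = real k' / real m' ^ j'" using q unfolding quot_monoid_def by blast
  have "real k / real m ^ j = real k' / real m' ^ j'" using k k' by simp
  then have "real (k * m' ^ j') = real (k' * m ^ j)" using assms by (simp add: field_simps)
  then have "m ^ j dvd k * m' ^ j'" by (simp only: of_nat_eq_iff) simp
  then have "m ^ j dvd k" using assms(1) by (simp add: coprime_dvd_mult_left_iff)
  then obtain l where "k = m ^ j * l" by blast
  then have "q = real l" using k assms by simp
  moreover have "q \<ge> 1" using q quot_monoid_ge_1 by auto
  ultimately show "q \<in> Npos" by (auto simp: Npos_def)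
qed

text \<open>Two expansions of one function over locally finite sets must agree. Their difference
  over the union represents 0, so uniqueness removes every coefficient outside the intersection.
  This is how the information from the bases 2 and 3 is combined.\<close>

lemma gds_Int:
  assumes h: "gds M \<sigma> B h" "gds M' \<sigma> B' h"
    and M: "M \<subseteq> {1..}" "\<And>X. finite (M \<inter> {..X})" "M' \<subseteq> {1..}" "\<And>X. finite (M' \<inter> {..X})"
  shows "gds (M \<inter> M') \<sigma> B h"
proof -
  obtain a T where a: "T \<le> B" "((\<lambda>q. cmod (a q) * q powr (-\<sigma>)) has_sum T) M"
     "\<And>s. Re s \<ge> \<sigma> \<Longrightarrow> ((\<lambda>q. a q * of_real q powr (-s)) has_sum h s) M"
    using h(1) unfolding gds_def gds_coeffs_def by blast
  obtain b U where b: "U \<le> B'" "((\<lambda>q. cmod (b q) * q powr (-\<sigma>)) has_sum U) M'"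
     "\<And>s. Re s \<ge> \<sigma> \<Longrightarrow> ((\<lambda>q. b q * of_real q powr (-s)) has_sum h s) M'"
    using h(2) unfolding gds_def gds_coeffs_def by blast
  let ?L = "M \<union> M'"
  define a' b' where "a' q = (if q \<in> M then a q else 0)" "b' q = (if q \<in> M' then b q else 0)" for q
  have a': "((\<lambda>q. cmod (a' q) * q powr (-\<sigma>)) has_sum T) ?L"
    using a(2) by (rule has_sum_cong_neutral[THEN iffD1, rotated -1]) (auto simp: a'_b'_def)
  have a'': "((\<lambda>q. a' q * of_real q powr (-s)) has_sum h s) ?L" if "Re s \<ge> \<sigma>" for s
    using a(3)[OF that] by (rule has_sum_cong_neutral[THEN iffD1, rotated -1]) (auto simp: a'_b'_def)
  have b': "((\<lambda>q. cmod (b' q) * q powr (-\<sigma>)) has_sum U) ?L"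
    using b(2) by (rule has_sum_cong_neutral[THEN iffD1, rotated -1]) (auto simp: a'_b'_def)
  have b'': "((\<lambda>q. b' q * of_real q powr (-s)) has_sum h s) ?L" if "Re s \<ge> \<sigma>" for s
    using b(3)[OF that] by (rule has_sum_cong_neutral[THEN iffD1, rotated -1]) (auto simp: a'_b'_def)
  define d where "d q = a' q - b' q" for q
  have sum: "((\<lambda>q. cmod (a' q) * q powr (-\<sigma>) + cmod (b' q) * q powr (-\<sigma>)) has_sum T + U) ?L"
    by (rule has_sum_add[OF a' b'])
  have le: "cmod (d q) * q powr (-\<sigma>) \<le> cmod (a' q) * q powr (-\<sigma>) + cmod (b' q) * q powr (-\<sigma>)" for q
    unfolding d_def distrib_right[symmetric] by (intro mult_right_mono norm_triangle_ineq4) auto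
  have sm: "(\<lambda>q. cmod (d q) * q powr (-\<sigma>)) summable_on ?L"
    by (rule summable_on_comparison_test[OF has_sum_imp_summable[OF sum]]) (use le in auto)
  have "((\<lambda>q. d q * of_real q powr (-s)) has_sum 0) ?L" if "Re s \<ge> \<sigma>" for s
    using has_sum_add[OF a''[OF that] has_sum_uminusI[OF b''[OF that]]]
    by (simp add: d_def algebra_simps)
  then have "gds_coeffs ?L \<sigma> (infsum (\<lambda>q. cmod (d q) * q powr (-\<sigma>)) ?L) d (\<lambda>s. 0)"
    using has_sum_infsum[OF sm] unfolding gds_coeffs_def by auto
  then have d0: "d q = 0" if "q \<in> ?L" for q
    by (rule gds_coeffs_unique) (use that M in \<open>auto simp: Int_Un_distrib2\<close>)
  have a0: "a q = 0" if "q \<in> M" "q \<notin> M'" for q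
    using d0[of q] that by (simp add: d_def a'_b'_def)
  have "((\<lambda>q. cmod (a q) * q powr (-\<sigma>)) has_sum T) (M \<inter> M')"
    using a(2) by (rule has_sum_cong_neutral[THEN iffD1, rotated -1]) (use a0 in auto)
  moreover have "((\<lambda>q. a q * of_real q powr (-s)) has_sum h s) (M \<inter> M')" if "Re s \<ge> \<sigma>" for s
    using a(3)[OF that] by (rule has_sum_cong_neutral[THEN iffD1, rotated -1]) (use a0 in auto)
  ultimately show ?thesis using a(1) unfolding gds_def gds_coeffs_def by auto
qed

subsection \<open>From the operator to the form of the symbol\<close>

lemma gds_cmult:
  assumes "gds M \<sigma> B g"
    and M: "M \<subseteq> {1..}" "1 \<in> M" "\<And>x y. x \<in> M \<Longrightarrow> y \<in> M \<Longrightarrow> x * y \<in> M"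
  shows "gds M \<sigma> (cmod c * B) (\<lambda>s. c * g s)"
proof -
  have "gds M \<sigma> (cmod c) (\<lambda>s. c * of_real 1 powr (-s))"
    by (rule gds_monomial) (use M in auto)
  then have "gds M \<sigma> (cmod c) (\<lambda>s. c)" by simp
  from gds_mult[OF this assms(1) M(1,3)] show ?thesis .
qed

text \<open>Distinct logarithms of the same number lie at least \<open>2 * pi\<close> apart, so
  \<open>D\<close> has discrete range, and a continuous function on a connected set with discrete
  range is constant.\<close>

lemma exp_eq_imp_constant:
  assumes "connected S" "continuous_on S D" "\<And>s. s \<in> S \<Longrightarrow> exp (D s) = (c::complex)"
  shows "\<exists>K. \<forall>s\<in>S. D s = K"
proof -
  have "D constant_on S"
  proof (rule continuous_discrete_range_constant[OF assms(1,2)])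
    fix x assume x: "x \<in> S"
    have "2 * pi \<le> cmod (D y - D x)" if "y \<in> S" "D y \<noteq> D x" for y
    proof (rule ccontr)
      assume "\<not> ?thesis"
      then have "\<bar>Im (D y) - Im (D x)\<bar> < 2 * pi"
        using abs_Im_le_cmod[of "D y - D x"] by simp
      then have "D y = D x" by (rule exp_complex_eqI) (use assms(3) x that in simp)
      with that show False by simp
    qed
    then show "\<exists>e>0. \<forall>y. y \<in> S \<and> D y \<noteq> D x \<longrightarrow> e \<le> cmod (D y - D x)"
      by (intro exI[of _ "2 * pi"]) auto
  qed
  then show ?thesis unfolding constant_on_def .
qed

text \<open>The logarithm series converges absolutely at radius
  \<open>B / cmod \<alpha> < 1\<close>. The constant \<open>K\<close> is included to absorb the
  choice of branch made later.\<close>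

lemma gds_Ln:
  assumes w: "gds M \<sigma> B w" and B: "0 < B" "B < cmod \<alpha>"
    and M: "M \<subseteq> {1..}" "1 \<in> M" "\<And>x y. x \<in> M \<Longrightarrow> y \<in> M \<Longrightarrow> x * y \<in> M"
  shows "\<exists>C. gds M \<sigma> C (\<lambda>s. K + Ln (1 + w s / \<alpha>))"
proof -
  \<comment> \<open>At \<open>j = 0\<close> the second summand is a division by zero, hence 0, and
    only \<open>K\<close> remains.\<close>
  define c where "c j = (if j = 0 then K else 0) + (-1) ^ Suc j / of_nat j / \<alpha> ^ j" for j
  have \<alpha>: "\<alpha> \<noteq> 0" using B by auto
  have "summable (\<lambda>j. (if j = 0 then cmod K else 0) + (B / cmod \<alpha>) ^ j)"
    using B by (intro summable_add summable_geometric) (auto simp: divide_less_eq)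
  then have "summable (\<lambda>j. cmod (c j) * B ^ j)"
  proof (rule summable_comparison_test')
    fix j :: nat
    have "cmod (c j) \<le> (if j = 0 then cmod K else 0) + cmod ((-1) ^ Suc j / of_nat j / \<alpha> ^ j)"
      unfolding c_def by (rule order_trans[OF norm_triangle_ineq]) auto
    also have "cmod ((-1) ^ Suc j / of_nat j / \<alpha> ^ j) = 1 / real j / cmod \<alpha> ^ j"
      by (simp add: norm_divide norm_mult norm_power)
    also have "\<dots> \<le> 1 / cmod \<alpha> ^ j"
      by (intro divide_right_mono) (auto simp: divide_le_eq)
    finally have "cmod (c j) * B ^ j \<le> ((if j = 0 then cmod K else 0) + 1 / cmod \<alpha> ^ j) * B ^ j"
      using B by (intro mult_right_mono) auto
    also have "\<dots> = (if j = 0 then cmod K else 0) + (B / cmod \<alpha>) ^ j"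
      by (simp add: algebra_simps power_divide)
    finally show "norm (cmod (c j) * B ^ j) \<le> (if j = 0 then cmod K else 0) + (B / cmod \<alpha>) ^ j"
      using B by simp
  qed
  from gds_power_series[OF w this M]
  have "gds M \<sigma> (\<Sum>j. cmod (c j) * B ^ j) (\<lambda>s. \<Sum>j. c j * w s ^ j)" .
  then have "gds M \<sigma> (\<Sum>j. cmod (c j) * B ^ j) (\<lambda>s. K + Ln (1 + w s / \<alpha>))"
  proof (rule gds_cong)
    fix s assume s: "Re s \<ge> \<sigma>"
    have "cmod (w s) \<le> B" by (rule gds_bound[OF w M(1) s])
    then have "cmod (w s / \<alpha>) < 1" using B by (simp add: norm_divide divide_less_eq)
    from Ln_series[OF this]
    have "(\<lambda>j. (-1) ^ Suc j / of_nat j * (w s / \<alpha>) ^ j) sums Ln (1 + w s / \<alpha>)" .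
    then have "(\<lambda>j. (if j = 0 then K else 0) + (-1) ^ Suc j / of_nat j * (w s / \<alpha>) ^ j) sums (K + Ln (1 + w s / \<alpha>))"
      by (intro sums_add) (use sums_single[of 0 "\<lambda>_. K"] in simp)
    moreover have "(if j = 0 then K else 0) + (-1) ^ Suc j / of_nat j * (w s / \<alpha>) ^ j = c j * w s ^ j" for j
      unfolding c_def using \<alpha> by (simp add: power_divide)
    ultimately show "(\<Sum>j. c j * w s ^ j) = K + Ln (1 + w s / \<alpha>)"
      by (simp add: sums_iff)
  qed
  then show ?thesis by blast
qed

text \<open>The exponential never vanishes, so its Dirichlet series has a leading term at some
  integer \<open>m\<close>, which contributes the linear part. The remaining factor is close to a
  nonzero constant far to the right, and its logarithm is again a series, now with frequencies in
  \<open>quot_monoid m\<close>.\<close>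

lemma log_affine_of_in_D:
  assumes cont: "continuous_on (half_plane \<theta>) \<psi>" and C: "C \<noteq> 0"
    and D: "in_D \<theta> (\<lambda>s. C * exp (\<psi> s))"
  obtains m \<sigma> B h where "m \<ge> 1" "\<sigma> > \<theta>" "gds (quot_monoid m) \<sigma> B h"
    "\<And>s. Re s \<ge> \<sigma> \<Longrightarrow> \<psi> s = - of_real (ln (real m)) * s + h s"
proof -
  obtain \<sigma> B a where \<sigma>: "\<sigma> > \<theta>" and a: "gds_coeffs Npos \<sigma> B a (\<lambda>s. C * exp (\<psi> s))"
    by (rule in_D_imp_gds[OF D])
  have "\<exists>q\<in>Npos. a q \<noteq> 0"
  proof (rule ccontr)
    assume *: "\<not> ?thesis"
    have "((\<lambda>q. a q * of_real q powr (- of_real \<sigma>)) has_sum C * exp (\<psi> (of_real \<sigma>))) Npos"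
      using a unfolding gds_coeffs_def by simp
    moreover have "((\<lambda>q. a q * of_real q powr (- of_real \<sigma>)) has_sum 0) Npos"
      by (rule has_sum_0) (use * in auto)
    ultimately show False using C has_sum_unique by fastforce
  qed
  from gds_leading[OF a Npos_ge_1 Npos_locally_finite this] obtain q0 \<delta> B' w where w: "q0 \<in> Npos" "a q0 \<noteq> 0" "\<delta> > 1"
    "gds ((\<lambda>q. q / q0) ` Npos \<inter> {\<delta>..}) \<sigma> B' w"
    "\<And>s. Re s \<ge> \<sigma> \<Longrightarrow> C * exp (\<psi> s) = of_real q0 powr (-s) * (a q0 + w s)" by blast
  obtain m where m: "q0 = real m" "m \<ge> 1" using w(1) by (auto simp: Npos_def)
  let ?M = "quot_monoid m" and ?N = "(\<lambda>q. q / q0) ` Npos \<inter> {\<delta>..}" and ?\<alpha> = "a q0"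
  \<comment> \<open>A quotient \<open>k / m\<close> above 1 has \<open>k \<ge> m + 1\<close>, which
    is the required bound with exponent 1.\<close>
  have sub: "?N \<subseteq> ?M"
  proof
    fix x assume x: "x \<in> ?N"
    then obtain k where k: "x = real k / real m" using m by (auto simp: Npos_def)
    have "x > 1" using x w(3) by auto
    then have "real k > real m" using k m by (simp add: field_simps)
    then have "real (Suc m) \<le> real k" by (simp only: of_nat_less_iff of_nat_le_iff Suc_le_eq)
    then have "real (Suc m) / real m \<le> real k / real m" by (rule divide_right_mono) simp
    then have "1 + 1 / real m \<le> real k / real m" using m(2) by (simp add: add_divide_distrib)
    then show "x \<in> ?M" unfolding quot_monoid_def k
      by (intro CollectI exI[of _ k] exI[of _ 1]) simp
  qed
  have "\<forall>\<^sub>F x in at_top. gds ?N x (cmod ?\<alpha> / 2) w \<and> x \<ge> \<sigma>"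
    using w(2) by (intro eventually_conj gds_eventually_small[OF w(4) _ w(3)] eventually_ge_at_top) auto
  then obtain \<tau> where \<tau>: "gds ?N \<tau> (cmod ?\<alpha> / 2) w" "\<tau> \<ge> \<sigma>"
    using eventually_happens'[OF trivial_limit_at_top_linorder] by blast
  have wM: "gds ?M \<tau> (cmod ?\<alpha> / 2) w" by (rule gds_mono[OF \<tau>(1) sub order_refl])
  \<comment> \<open>Radius 1/2 keeps \<open>1 + w s / ?\<alpha>\<close> off the branch cut and
    inside the disc of the logarithm series.\<close>
  have w_small: "cmod (w s / ?\<alpha>) \<le> 1 / 2" if "Re s \<ge> \<tau>" for s
    using gds_bound[OF wM quot_monoid_ge_1 that] w(2) by (simp add: norm_divide field_simps)
  have mz: "of_real q0 powr z = exp (z * of_real (ln (real m)))" for z :: complex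
    using m by (simp add: powr_def Ln_of_nat)
  have eq: "C * exp (\<psi> s) * exp (s * of_real (ln (real m))) = ?\<alpha> + w s" if "Re s \<ge> \<tau>" for s
  proof -
    have "C * exp (\<psi> s) * exp (s * of_real (ln (real m))) =
       exp (- s * of_real (ln (real m))) * exp (s * of_real (ln (real m))) * (?\<alpha> + w s)"
      using w(5)[of s] that \<tau>(2) mz[of "-s"] by simp
    also have "exp (- s * of_real (ln (real m))) * exp (s * of_real (ln (real m))) = 1"
      by (simp add: exp_minus_inverse exp_minus)
    finally show ?thesis by simp
  qed
  let ?S = "{s. Re s \<ge> \<tau>}"
  \<comment> \<open>\<open>D\<close> compares \<open>\<psi>\<close> with the logarithm built from
    the series. Its exponential is the constant \<open>?\<alpha> / C\<close>, so \<open>D\<close>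
    itself is constant.\<close>
  define D where "D s = \<psi> s + s * of_real (ln (real m)) - Ln (1 + w s / ?\<alpha>)" for s
  have nz: "1 + w s / ?\<alpha> \<noteq> 0" "1 + w s / ?\<alpha> \<notin> \<real>\<^sub>\<le>\<^sub>0" if "Re s \<ge> \<tau>" for s
  proof -
    have "Re (1 + w s / ?\<alpha>) > 0"
      using abs_Re_le_cmod[of "w s / ?\<alpha>"] w_small[OF that] by simp
    then show "1 + w s / ?\<alpha> \<notin> \<real>\<^sub>\<le>\<^sub>0" by (auto simp: complex_nonpos_Reals_iff)
    then show "1 + w s / ?\<alpha> \<noteq> 0" by (metis nonpos_Reals_zero_I)
  qed
  have cont': "continuous_on ?S \<psi>"
    by (rule continuous_on_subset[OF cont]) (use \<sigma> \<tau>(2) in \<open>auto simp: half_plane_def\<close>)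
  \<comment> \<open>Continuity of \<open>w\<close> is read off from \<open>eq\<close>, which
    expresses \<open>w\<close> through \<open>\<psi>\<close>.\<close>
  have "continuous_on ?S (\<lambda>s. C * exp (\<psi> s) * exp (s * of_real (ln (real m))) - ?\<alpha>)"
    by (intro continuous_intros cont')
  then have contw: "continuous_on ?S w"
    by (rule continuous_on_cong[THEN iffD1, rotated -1]) (use eq in auto)
  have "\<exists>K. \<forall>s\<in>?S. D s = K"
  proof (rule exp_eq_imp_constant)
    show "connected ?S" by (intro convex_connected convex_halfspace_Re_ge)
    show "continuous_on ?S D"
      unfolding D_def by (intro continuous_intros cont' contw) (use nz w(2) in auto)
    show "exp (D s) = ?\<alpha> / C" if "s \<in> ?S" for s
    proof -
      have s: "Re s \<ge> \<tau>" using that by simp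
      have "exp (D s) = exp (\<psi> s) * exp (s * of_real (ln (real m))) / (1 + w s / ?\<alpha>)"
        unfolding D_def using nz(1)[OF s] by (simp add: exp_add exp_diff)
      also have "1 + w s / ?\<alpha> = C * exp (\<psi> s) * exp (s * of_real (ln (real m))) / ?\<alpha>"
        unfolding eq[OF s] using w(2) by (simp add: field_simps)
      finally show ?thesis using C w(2) by simp
    qed
  qed
  then obtain K where K: "\<And>s. s \<in> ?S \<Longrightarrow> D s = K" by blast
  have "\<exists>B. gds ?M \<tau> B (\<lambda>s. K + Ln (1 + w s / ?\<alpha>))"
    by (rule gds_Ln[OF wM]) (use w(2) quot_monoid_ge_1 one_quot_monoid quot_monoid_mult in auto)
  then obtain B where "gds ?M \<tau> B (\<lambda>s. K + Ln (1 + w s / ?\<alpha>))" by blast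
  moreover have "\<psi> s = - of_real (ln (real m)) * s + (K + Ln (1 + w s / ?\<alpha>))" if "Re s \<ge> \<tau>" for s
    using K[of s] that by (simp add: D_def algebra_simps)
  ultimately show ?thesis using that[of m \<tau> B] m(2) \<sigma> \<tau>(2) by simp
qed

section \<open>Testing the operator on monomials and comparing the resulting slopes\<close>

lemma monomial_in_D: "in_D \<theta> (\<lambda>s. c * of_real (real n) powr (-s))" if "n \<ge> 1"
proof -
  have "gds Npos 0 (cmod c * real n powr (-0)) (\<lambda>s. c * of_real (real n) powr (-s))"
    by (rule gds_monomial) (use that Npos_ge_1 in \<open>auto simp: Npos_def\<close>)
  then show ?thesis by (rule gds_imp_in_D) simp
qed

lemma affine_bounded_imp_eq:
  fixes a b x0 :: real
  assumes "\<And>x. x \<ge> x0 \<Longrightarrow> \<bar>(a - b) * x\<bar> \<le> B"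
  shows "a = b"
proof (rule ccontr)
  assume "a \<noteq> b"
  then have pos: "\<bar>a - b\<bar> > 0" by simp
  define x where "x = max x0 ((\<bar>B\<bar> + 1) / \<bar>a - b\<bar>)"
  have le: "(\<bar>B\<bar> + 1) / \<bar>a - b\<bar> \<le> x" and "0 < (\<bar>B\<bar> + 1) / \<bar>a - b\<bar>" using pos by (auto simp: x_def)
  then have "x > 0" by linarith
  with le have "\<bar>B\<bar> + 1 \<le> \<bar>(a - b) * x\<bar>" using pos
    by (auto simp add: abs_mult pos_divide_le_eq mult.commute)
  moreover have "\<bar>(a - b) * x\<bar> \<le> B" by (rule assms) (simp add: x_def)
  ultimately show False by simp
qed

lemma affine_form_of_comp_in_D:
  assumes hol: "\<Phi> holomorphic_on half_plane \<theta>"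
    and D: "\<And>f. f holomorphic_on half_plane (1/2) \<Longrightarrow> in_D (1/2) f \<Longrightarrow> in_D \<theta> (\<lambda>s. deriv f (\<Phi> s))"
  shows "\<exists>c::nat. in_D \<theta> (\<lambda>s. \<Phi> s - of_nat c * s)"
proof -
  have *: "\<exists>m \<sigma> B h. m \<ge> 1 \<and> \<sigma> > \<theta> \<and> gds (quot_monoid m) \<sigma> B h \<and>
     (\<forall>s. Re s \<ge> \<sigma> \<longrightarrow> \<Phi> s = of_real (ln (real m) / ln (real n)) * s + h s)" if n: "n \<ge> 2" for n :: nat
  proof -
    \<comment> \<open>The derivative of this monomial composed with \<open>\<Phi>\<close> is a
      nonzero constant times an exponential, the situation of
      \<open>log_affine_of_in_D\<close>.\<close>
    let ?f = "\<lambda>s. 1 * complex_of_real (real n) powr (-s)"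
    have f: "?f = (\<lambda>s. exp (- s * of_real (ln (real n))))"
      using n by (auto simp: powr_def Ln_of_nat)
    have der: "deriv ?f s = - of_real (ln (real n)) * exp (- s * of_real (ln (real n)))" for s
      unfolding f by (rule DERIV_imp_deriv) (auto intro!: derivative_eq_intros)
    have "in_D \<theta> (\<lambda>s. deriv ?f (\<Phi> s))"
      by (rule D[OF _ monomial_in_D]) (use n in \<open>auto simp: f intro!: holomorphic_intros\<close>)
    then have D': "in_D \<theta> (\<lambda>s. - of_real (ln (real n)) * exp (- \<Phi> s * of_real (ln (real n))))"
      unfolding der .
    have ln: "ln (real n) > 0" using n by simp
    obtain m \<sigma> B h where m: "m \<ge> 1" "\<sigma> > \<theta>" "gds (quot_monoid m) \<sigma> B h"
      "\<And>s. Re s \<ge> \<sigma> \<Longrightarrow> - \<Phi> s * of_real (ln (real n)) = - of_real (ln (real m)) * s + h s"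
    proof (rule log_affine_of_in_D[OF _ _ D'])
      show "continuous_on (half_plane \<theta>) (\<lambda>s. - \<Phi> s * of_real (ln (real n)))"
        using holomorphic_on_imp_continuous_on[OF hol] by (intro continuous_intros)
    qed (use ln in auto)
    let ?c = "- 1 / complex_of_real (ln (real n))"
    have "gds (quot_monoid m) \<sigma> (cmod ?c * B) (\<lambda>s. ?c * h s)"
      by (rule gds_cmult[OF m(3) quot_monoid_ge_1 one_quot_monoid quot_monoid_mult])
    moreover have "\<Phi> s = of_real (ln (real m) / ln (real n)) * s + ?c * h s" if "Re s \<ge> \<sigma>" for s
      using m(4)[OF that] ln by (simp add: field_simps)
    ultimately show ?thesis using m(1,2) by blast
  qed
  obtain m2 \<sigma>2 B2 h2 where 2: "m2 \<ge> 1" "\<sigma>2 > \<theta>" "gds (quot_monoid m2) \<sigma>2 B2 h2"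
     "\<And>s. Re s \<ge> \<sigma>2 \<Longrightarrow> \<Phi> s = of_real (ln (real m2) / ln (real 2)) * s + h2 s"
    using *[of 2] by auto
  define c where "c = ln (real m2) / ln (real 2)"
  \<comment> \<open>At real \<open>x\<close> far to the right, the difference of the two slopes
    times \<open>x\<close> equals a difference of two series, each bounded by its weighted norm.
    Hence the slopes agree.\<close>
  have c_eq: "ln (real m) / ln (real n) = c"
    if "gds (quot_monoid m) \<sigma> B h" "\<And>s. Re s \<ge> \<sigma> \<Longrightarrow> \<Phi> s = of_real (ln (real m) / ln (real n)) * s + h s"
    for m n :: nat and \<sigma> B h
  proof (rule affine_bounded_imp_eq)
    fix x :: real assume x: "x \<ge> max \<sigma> \<sigma>2"
    have "of_real ((ln (real m) / ln (real n) - c) * x) = h2 (of_real x) - h (of_real x)"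
      using that(2)[of "of_real x"] 2(4)[of "of_real x"] x by (simp add: c_def algebra_simps)
    then have "\<bar>(ln (real m) / ln (real n) - c) * x\<bar> = cmod (h2 (of_real x) - h (of_real x))"
      by (metis norm_of_real)
    also have "\<dots> \<le> B2 + B"
      using gds_bound[OF 2(3) quot_monoid_ge_1, of "of_real x"] gds_bound[OF that(1) quot_monoid_ge_1, of "of_real x"] x
      by (intro order_trans[OF norm_triangle_ineq4] add_mono) auto
    finally show "\<bar>(ln (real m) / ln (real n) - c) * x\<bar> \<le> B2 + B" .
  qed
  \<comment> \<open>A common slope means that \<open>n powr c\<close> is the leading index
    \<open>m\<close>, in particular an integer.\<close>
  have powr_c: "real m = real n powr c" if "ln (real m) / ln (real n) = c" "n \<ge> 2" "m \<ge> 1" for m n :: nat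
  proof -
    have "ln (real m) = c * ln (real n)" using that(1)[symmetric] that(2) by simp
    then have "exp (ln (real m)) = real n powr c" using that(2) by (simp add: powr_def)
    then show ?thesis using that(3) by simp
  qed
  have "\<exists>k::nat. c = real k"
  proof (rule nat_exponent_of_integral_powers)
    fix n :: nat assume "n \<ge> 1"
    show "real n powr c \<in> \<int>"
    proof (cases "n = 1")
      case False
      with \<open>n \<ge> 1\<close> have n: "n \<ge> 2" by simp
      obtain m \<sigma> B h where m: "m \<ge> 1" "gds (quot_monoid m) \<sigma> B h"
         "\<And>s. Re s \<ge> \<sigma> \<Longrightarrow> \<Phi> s = of_real (ln (real m) / ln (real n)) * s + h s"
        using *[OF n] by auto
      show ?thesis using powr_c[OF c_eq[OF m(2,3)] n m(1)] by (metis Ints_of_nat)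
    qed auto
  qed
  then obtain k where k: "c = real k" by blast
  obtain m3 \<sigma>3 B3 h3 where 3: "m3 \<ge> 1" "\<sigma>3 > \<theta>" "gds (quot_monoid m3) \<sigma>3 B3 h3"
     "\<And>s. Re s \<ge> \<sigma>3 \<Longrightarrow> \<Phi> s = of_real (ln (real m3) / ln (real 3)) * s + h3 s"
    using *[of 3] by auto
  have c3: "ln (real m3) / ln (real 3) = c" by (rule c_eq[OF 3(3,4)])
  have pow: "m = n ^ k" if "ln (real m) / ln (real n) = c" "n \<ge> 2" "m \<ge> 1" for m n :: nat
  proof -
    have "real m = real (n ^ k)" using powr_c[OF that] that(2) by (simp add: k powr_realpow)
    then show ?thesis by (simp only: of_nat_eq_iff)
  qed
  have "m2 = 2 ^ k" by (rule pow) (use 2(1) in \<open>auto simp: c_def\<close>)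
  moreover have "m3 = 3 ^ k" by (rule pow) (use 3(1) c3 in auto)
  \<comment> \<open>The leading indices for the bases 2 and 3 are powers of 2 and of 3.\<close>
  ultimately have cop: "coprime m2 m3" by (simp add: coprime_power_left_iff coprime_power_right_iff)
  define \<sigma> where "\<sigma> = max \<sigma>2 \<sigma>3"
  have h3: "gds (quot_monoid m3) \<sigma> B3 h3"
    using gds_shift[OF 3(3) quot_monoid_ge_1, of \<sigma>] by (simp add: \<sigma>_def)
  have h2: "gds (quot_monoid m2) \<sigma> B2 h2"
    using gds_shift[OF 2(3) quot_monoid_ge_1, of \<sigma>] by (simp add: \<sigma>_def)
  have h23: "h3 s = h2 s" if "Re s \<ge> \<sigma>" for s
  proof -
    have "\<Phi> s = of_real c * s + h3 s" using 3(4)[of s] that unfolding c3 by (simp add: \<sigma>_def)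
    moreover have "\<Phi> s = of_real c * s + h2 s" using 2(4)[of s] that by (simp add: \<sigma>_def c_def)
    ultimately show ?thesis by simp
  qed
  have "gds (quot_monoid m2 \<inter> quot_monoid m3) \<sigma> B2 h2"
    by (rule gds_Int[OF h2 gds_cong[OF h3 h23] quot_monoid_ge_1 quot_monoid_locally_finite[OF 2(1)] quot_monoid_ge_1 quot_monoid_locally_finite[OF 3(1)]])
  then have "gds Npos \<sigma> B2 h2"
    by (rule gds_mono[OF _ quot_monoid_Int_subset_Npos[OF cop 2(1) 3(1)] order_refl])
  then have "in_D \<theta> (\<lambda>s. \<Phi> s - of_nat k * s)"
  proof (rule gds_imp_in_D)
    fix s assume "Re s > \<sigma>"
    then have "\<Phi> s = of_real c * s + h2 s" using 2(4)[of s] by (simp add: c_def \<sigma>_def)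
    then show "h2 s = \<Phi> s - of_nat k * s" by (simp add: k)
  qed
  then show ?thesis by blast
qed

subsection \<open>From the form of the symbol to the operator\<close>

text \<open>The explicit bound matters: for \<open>cmod z = ln n\<close> and \<open>B = 1\<close> it
  equals \<open>n\<close>, a loss of one power of \<open>n\<close> that a shift of the abscissa can
  repay.\<close>

lemma gds_exp:
  assumes w: "gds M \<sigma> B w"
    and M: "M \<subseteq> {1..}" "1 \<in> M" "\<And>x y. x \<in> M \<Longrightarrow> y \<in> M \<Longrightarrow> x * y \<in> M"
  shows "gds M \<sigma> (exp (cmod z * B)) (\<lambda>s. exp (z * w s))"
proof -
  have s: "(\<lambda>j. cmod (z ^ j / fact j) * B ^ j) sums exp (cmod z * B)"
    using exp_converges[of "cmod z * B"]
    by (simp add: norm_divide norm_power power_mult_distrib field_simps)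
  have "gds M \<sigma> (\<Sum>j. cmod (z ^ j / fact j) * B ^ j) (\<lambda>s. \<Sum>j. z ^ j / fact j * w s ^ j)"
    by (rule gds_power_series[OF w sums_summable[OF s] M])
  moreover have "(\<Sum>j. z ^ j / fact j * w s ^ j) = exp (z * w s)" for s
    using exp_converges[of "z * w s"]
    by (simp add: sums_iff power_mult_distrib scaleR_conv_of_real field_simps)
  ultimately show ?thesis using sums_unique[OF s] by simp
qed

text \<open>Without the constant term all frequencies are at least 2, so
  \<open>gds_eventually_small\<close> applies to the rest.\<close>

lemma gds_split_constant:
  assumes g: "gds_coeffs Npos \<sigma> B a g"
  shows "gds_coeffs (Npos \<inter> {2..}) \<sigma> B a (\<lambda>s. g s - a 1)"
proof -
  obtain T where a: "T \<le> B" "((\<lambda>q. cmod (a q) * q powr (-\<sigma>)) has_sum T) Npos"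
     "\<And>s. Re s \<ge> \<sigma> \<Longrightarrow> ((\<lambda>q. a q * of_real q powr (-s)) has_sum g s) Npos"
    using g unfolding gds_coeffs_def by blast
  have eq: "Npos \<inter> {2..} = Npos - {1}" by (auto simp: Npos_def)
  have "((\<lambda>q. cmod (a q) * q powr (-\<sigma>)) has_sum (T - cmod (a 1))) (Npos - {1})"
    by (rule has_sum_Diff[OF a(2)]) (use one_Npos in \<open>auto intro: has_sum_finiteI\<close>)
  moreover have "((\<lambda>q. a q * of_real q powr (-s)) has_sum (g s - a 1)) (Npos - {1})" if "Re s \<ge> \<sigma>" for s
    by (rule has_sum_Diff[OF a(3)[OF that]]) (use one_Npos in \<open>auto intro: has_sum_finiteI\<close>)
  moreover have "T - cmod (a 1) \<le> B" using a(1) norm_ge_zero[of "a 1"] by linarith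
  ultimately show ?thesis unfolding gds_coeffs_def eq by blast
qed

text \<open>Termwise differentiation multiplies the coefficients by \<open>- ln n\<close>; since
  \<open>ln n \<le> n\<close>, this costs one unit of abscissa.\<close>

lemma deriv_gds_coeffs:
  assumes f: "gds_coeffs Npos \<sigma> B a f"
  obtains A :: "nat \<Rightarrow> complex"
  where "summable (\<lambda>n. cmod (A n) * real (Suc n) powr (-(\<sigma> + 1)))"
    and "\<And>z. Re z > \<sigma> + 1 \<Longrightarrow> (\<lambda>n. A n * of_real (real (Suc n)) powr (-z)) sums deriv f z"
proof -
  obtain T where a: "((\<lambda>q. cmod (a q) * q powr (-\<sigma>)) has_sum T) Npos"
     "\<And>s. Re s \<ge> \<sigma> \<Longrightarrow> ((\<lambda>q. a q * of_real q powr (-s)) has_sum f s) Npos"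
    using f unfolding gds_coeffs_def by blast
  define N where "N n = real (Suc n)" for n
  have N: "N n \<ge> 1" for n by (simp add: N_def)
  have bij: "bij_betw N UNIV Npos" using bij_Npos unfolding N_def .
  have "((\<lambda>n. cmod (a (N n)) * N n powr (-\<sigma>)) has_sum T) UNIV"
    using a(1) by (subst has_sum_reindex_bij_betw[OF bij])
  then have smT: "summable (\<lambda>n. cmod (a (N n)) * N n powr (-\<sigma>))"
    using has_sum_imp_sums sums_summable by blast
  have fs: "(\<lambda>n. a (N n) * of_real (N n) powr (-s)) sums f s" if "Re s \<ge> \<sigma>" for s
  proof (rule has_sum_imp_sums)
    show "((\<lambda>n. a (N n) * of_real (N n) powr (-s)) has_sum f s) UNIV"
      using a(2)[OF that] by (subst has_sum_reindex_bij_betw[OF bij, where f="\<lambda>q. a q * of_real q powr (-s)"])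
  qed
  define A where "A n = - a (N n) * of_real (ln (N n))" for n
  have le: "cmod (A n) * N n powr (-(\<sigma> + 1)) \<le> cmod (a (N n)) * N n powr (-\<sigma>)" for n
  proof -
    have "ln (N n) \<le> N n" using ln_le_minus_one[of "N n"] N[of n] by simp
    have "cmod (A n) * N n powr (-(\<sigma> + 1)) = cmod (a (N n)) * (ln (N n) * N n powr (-\<sigma> - 1))"
      using N[of n] by (simp add: A_def norm_mult)
    also have "\<dots> \<le> cmod (a (N n)) * (N n * N n powr (-\<sigma> - 1))"
      using \<open>ln (N n) \<le> N n\<close> by (intro mult_left_mono mult_right_mono) auto
    also have "N n * N n powr (-\<sigma> - 1) = N n powr (-\<sigma>)"
      using N[of n] by (simp add: powr_diff)
    finally show ?thesis .
  qed
  have smA: "summable (\<lambda>n. cmod (A n) * N n powr (-(\<sigma> + 1)))"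
    by (rule summable_comparison_test'[OF smT]) (use le in auto)
  let ?S = "{z. Re z > \<sigma> + 1}"
  have op: "open ?S" by (rule open_halfspace_Re_gt)
  \<comment> \<open>Termwise differentiation rests on uniform convergence of the differentiated
    series, together with convergence of the original one at a point.\<close>
  have unif: "uniform_limit ?S (\<lambda>n z. \<Sum>i<n. A i * of_real (N i) powr (-z)) (\<lambda>z. \<Sum>i. A i * of_real (N i) powr (-z)) sequentially"
    proof (rule Weierstrass_m_test[OF _ smA])
    show "norm (A n * of_real (N n) powr (-z)) \<le> cmod (A n) * N n powr (-(\<sigma> + 1))" if "z \<in> ?S" for n z
      by (rule norm_term_le[OF N]) (use that in simp)
  qed
  have "(\<lambda>n. A n * of_real (N n) powr (-z)) sums deriv f z" if z: "Re z > \<sigma> + 1" for z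
  proof -
    have der: "((\<lambda>z. a (N n) * of_real (N n) powr (-z)) has_field_derivative A n * of_real (N n) powr (-z)) (at z within ?S)" for n z
    proof -
      have pw: "complex_of_real (N n) powr (-z) = exp (- z * of_real (ln (N n)))" for z
        using N[of n] by (simp add: powr_def Ln_of_real)
      show ?thesis unfolding A_def pw by (auto intro!: derivative_eq_intros)
    qed
    have "((\<lambda>z. \<Sum>n. a (N n) * of_real (N n) powr (-z)) has_field_derivative (\<Sum>n. A n * of_real (N n) powr (-z))) (at z)"
    proof (rule has_field_derivative_series'(2)[where S="?S" and x0=z])
      show "convex ?S" by (rule convex_halfspace_Re_gt)
      show "uniformly_convergent_on ?S (\<lambda>n z. \<Sum>i<n. A i * of_real (N i) powr (-z))"
        using unif by (rule uniformly_convergentI)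
      show "summable (\<lambda>n. a (N n) * of_real (N n) powr (-z))"
        using fs[of z] z by (auto intro: sums_summable)
      show "z \<in> interior ?S" using z op by (simp add: interior_open)
    qed (use z der in auto)
    then have "(f has_field_derivative (\<Sum>n. A n * of_real (N n) powr (-z))) (at z)"
      by (rule has_field_derivative_transform_within_open[OF _ op]) (use z fs in \<open>auto simp: sums_iff\<close>)
    then have "deriv f z = (\<Sum>n. A n * of_real (N n) powr (-z))" by (rule DERIV_imp_deriv)
    moreover have "summable (\<lambda>n. A n * of_real (N n) powr (-z))"
    proof (rule summable_norm_cancel, rule summable_comparison_test'[OF smA])
      show "norm (norm (A n * of_real (N n) powr (-z))) \<le> cmod (A n) * N n powr (-(\<sigma> + 1))" for n
        unfolding real_norm_def abs_norm_cancel by (rule norm_term_le) (use N z in auto)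
    qed
    ultimately show ?thesis by (simp add: sums_iff)
  qed
  with smA show ?thesis using that unfolding N_def by blast
qed

text \<open>Because \<open>c \<ge> 1\<close>, \<open>Re (\<Phi> s)\<close> grows with
  \<open>Re s\<close> and reaches the half-plane where the series of \<open>deriv f\<close>
  converges. Each term becomes a monomial times an exponential of \<open>w\<close>; the issue is to
  sum their norms over \<open>n\<close>.\<close>

lemma deriv_comp_in_D:
  assumes f: "in_D (1/2) f" and \<phi>: "in_D \<theta> \<phi>" and c: "c \<ge> 1"
    and \<Phi>: "\<And>s. s \<in> half_plane \<theta> \<Longrightarrow> \<Phi> s = of_nat c * s + \<phi> s"
  shows "in_D \<theta> (\<lambda>s. deriv f (\<Phi> s))"
proof -
  obtain \<sigma>' B a where a: "gds_coeffs Npos \<sigma>' B a f" by (rule in_D_imp_gds[OF f])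
  obtain A where A: "summable (\<lambda>n. cmod (A n) * real (Suc n) powr (-(\<sigma>' + 1)))"
    "\<And>z. Re z > \<sigma>' + 1 \<Longrightarrow> (\<lambda>n. A n * of_real (real (Suc n)) powr (-z)) sums deriv f z"
    using deriv_gds_coeffs[OF a] by blast
  define \<sigma> where "\<sigma> = \<sigma>' + 1"
  obtain \<tau> C b where \<tau>: "\<tau> > \<theta>" and b: "gds_coeffs Npos \<tau> C b \<phi>" by (rule in_D_imp_gds[OF \<phi>])
  define w where "w s = \<phi> s - b 1" for s
  have "gds (Npos \<inter> {2..}) \<tau> C w"
    using gds_split_constant[OF b] unfolding gds_def w_def by blast
  then have "\<forall>\<^sub>F x in at_top. gds (Npos \<inter> {2..}) x 1 w"
    by (rule gds_eventually_small[where \<delta>=2]) auto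
  then have "\<forall>\<^sub>F x in at_top. gds (Npos \<inter> {2..}) x 1 w \<and> x \<ge> max \<tau> (max 1 (\<sigma> + cmod (b 1) + 2))"
    using eventually_ge_at_top by (rule eventually_conj)
  \<comment> \<open>The margin pays for \<open>n powr cmod (b 1)\<close> from the constant term, for
    the factor \<open>n\<close> from the exponential, and for the loss \<open>cmod (b 1) + 1\<close>
    in \<open>Re (\<Phi> s)\<close>. As \<open>x \<ge> 1\<close>, passing from \<open>n\<close> to
    \<open>n ^ c\<close> only decreases the weight.\<close>
  then obtain x where x: "gds (Npos \<inter> {2..}) x 1 w" "x \<ge> \<tau>" "x \<ge> 1" "x \<ge> \<sigma> + cmod (b 1) + 2"
    using eventually_happens'[OF trivial_limit_at_top_linorder] by fastforce
  have w: "gds Npos x 1 w" by (rule gds_mono[OF x(1)]) auto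
  define N where "N n = real (Suc n)" for n
  have N: "N n \<ge> 1" for n by (simp add: N_def)
  \<comment> \<open>The term of \<open>deriv f\<close> at \<open>\<Phi> s\<close>, split along
    \<open>\<Phi> s = c * s + b 1 + w s\<close> into a constant, the frequency
    \<open>N n ^ c\<close> and an exponential.\<close>
  define t where "t n s = (A n * of_real (N n) powr (- b 1)) * of_real (N n ^ c) powr (-s) * exp (- of_real (ln (N n)) * w s)" for n s
  have "gds Npos x (cmod (A n) * N n powr (-\<sigma>)) (t n)" for n
  proof -
    have "gds Npos x (cmod (A n * of_real (N n) powr (- b 1)) * (N n ^ c) powr (-x))
       (\<lambda>s. (A n * of_real (N n) powr (- b 1)) * of_real (N n ^ c) powr (-s))"
    proof (rule gds_monomial[OF _ Npos_ge_1 order_refl])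
      have "N n ^ c = real (Suc n ^ c)" by (simp add: N_def)
      then show "N n ^ c \<in> Npos" unfolding Npos_def by (intro image_eqI[of _ _ "Suc n ^ c"]) auto
    qed
    from gds_mult[OF this gds_exp[OF w Npos_ge_1 one_Npos Npos_mult] Npos_ge_1 Npos_mult]
    have "gds Npos x (cmod (A n * of_real (N n) powr (- b 1)) * (N n ^ c) powr (-x) * exp (cmod (- of_real (ln (N n))) * 1)) (t n)"
      unfolding t_def .
    moreover have "cmod (A n * of_real (N n) powr (- b 1)) * (N n ^ c) powr (-x) * exp (cmod (- of_real (ln (N n))) * 1)
       \<le> cmod (A n) * N n powr (-\<sigma>)"
    proof -
      have 1: "cmod (of_real (N n) powr (- b 1)) \<le> N n powr cmod (b 1)"
        using N[of n] abs_Re_le_cmod[of "b 1"] by (subst norm_powr_neg) (auto intro!: powr_mono)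
      have 2: "(N n ^ c) powr (-x) \<le> N n powr (-x)"
        using N[of n] x(3) c self_le_power[of "N n" c] by (intro powr_mono2') auto
      have 3: "exp (cmod (- of_real (ln (N n))) * 1) = N n powr 1" using N[of n] by simp
      have "cmod (A n * of_real (N n) powr (- b 1)) * (N n ^ c) powr (-x) * exp (cmod (- of_real (ln (N n))) * 1)
         \<le> cmod (A n) * N n powr cmod (b 1) * N n powr (-x) * N n powr 1"
        unfolding 3 norm_mult by (intro mult_mono 1 2) auto
      also have "\<dots> = cmod (A n) * N n powr (cmod (b 1) - x + 1)"
        unfolding mult.assoc by (simp only: powr_add[symmetric]) (simp add: algebra_simps)
      also have "\<dots> \<le> cmod (A n) * N n powr (-\<sigma>)"
        using N[of n] x(4) by (intro mult_left_mono powr_mono) auto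
      finally show ?thesis .
    qed
    ultimately show ?thesis by (rule gds_mono[OF _ order_refl])
  qed
  moreover have "summable (\<lambda>n. cmod (A n) * N n powr (-\<sigma>))" using A(1) unfolding N_def \<sigma>_def .
  ultimately have "gds Npos x (\<Sum>n. cmod (A n) * N n powr (-\<sigma>)) (\<lambda>s. \<Sum>n. t n s)"
    by (rule gds_suminf[OF _ _ Npos_ge_1])
  then show ?thesis
  proof (rule gds_imp_in_D)
    fix s assume s: "Re s > x" "Re s > \<theta>"
    have \<Phi>s: "\<Phi> s = of_nat c * s + b 1 + w s" using \<Phi>[of s] s by (simp add: half_plane_def w_def)
    have "cmod (w s) \<le> 1" by (rule gds_bound[OF w Npos_ge_1]) (use s in auto)
    then have "Re (\<Phi> s) \<ge> real c * Re s - cmod (b 1) - 1"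
      using abs_Re_le_cmod[of "b 1"] abs_Re_le_cmod[of "w s"] unfolding \<Phi>s by simp
    moreover have "real c * Re s \<ge> 1 * Re s" using c s x(3) by (intro mult_right_mono) auto
    ultimately have "Re (\<Phi> s) > \<sigma>" using s(1) x(4) by simp
    then have "(\<lambda>n. A n * of_real (N n) powr (-\<Phi> s)) sums deriv f (\<Phi> s)"
      using A(2) unfolding \<sigma>_def N_def by blast
    moreover have "A n * of_real (N n) powr (-\<Phi> s) = t n s" for n
    proof -
      have "of_real (N n ^ c) powr (-s) = exp (- s * of_real (ln (N n ^ c)))"
        using N[of n] by (simp add: powr_def Ln_of_real del: of_real_power)
      also have "ln (N n ^ c) = real c * ln (N n)" using N[of n] by (simp add: ln_realpow)
      finally show ?thesis using N[of n]
        unfolding t_def \<Phi>s by (simp add: powr_def Ln_of_real exp_add[symmetric] algebra_simps)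
    qed
    ultimately show "(\<Sum>n. t n s) = deriv f (\<Phi> s)" by (simp add: sums_iff)
  qed
qed

text \<open>Unless \<open>\<phi>\<close> is constant, its first nonconstant term dominates far to the right and takes
  negative real values there, so \<open>Re \<phi>\<close> drops strictly below the real part of the constant term.\<close>

lemma leading_coeff_Re_gt:
  assumes b: "gds_coeffs Npos \<tau> C b \<phi>" and pos: "\<And>s. Re s \<ge> \<tau> \<Longrightarrow> Re (\<phi> s) > \<rho>"
  shows "Re (b 1) > \<rho>"
proof -
  define w where "w s = \<phi> s - b 1" for s
  let ?L = "Npos \<inter> {2..}"
  have w: "gds_coeffs ?L \<tau> C b w"
    using gds_split_constant[OF b] unfolding w_def .
  show ?thesis
  proof (cases "\<exists>q\<in>?L. b q \<noteq> 0")
    case False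
    \<comment> \<open>Here \<open>\<phi>\<close> already equals its constant term at
      \<open>\<tau>\<close>.\<close>
    have "((\<lambda>q. b q * of_real q powr (- of_real \<tau>)) has_sum w (of_real \<tau>)) ?L"
      using w unfolding gds_coeffs_def by simp
    moreover have "((\<lambda>q. b q * of_real q powr (- of_real \<tau>)) has_sum 0) ?L"
      by (rule has_sum_0) (use False in auto)
    ultimately have "w (of_real \<tau>) = 0" by (rule has_sum_unique)
    then show ?thesis using pos[of "of_real \<tau>"] by (simp add: w_def)
  next
    case True
    have "?L \<subseteq> {1..}" "\<And>X. finite (?L \<inter> {..X})"
      using Npos_ge_1 by (auto intro: finite_subset[OF _ Npos_locally_finite])
    from gds_leading[OF w this True] obtain q \<delta> B v where v: "q \<in> ?L" "b q \<noteq> 0" "\<delta> > 1"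
      "gds ((\<lambda>p. p / q) ` ?L \<inter> {\<delta>..}) \<tau> B v"
      "\<And>s. Re s \<ge> \<tau> \<Longrightarrow> w s = of_real q powr (-s) * (b q + v s)" by blast
    let ?M = "(\<lambda>p. p / q) ` ?L \<inter> {\<delta>..}" and ?\<alpha> = "b q"
    have "\<forall>\<^sub>F x in at_top. gds ?M x (cmod ?\<alpha> / 2) v \<and> x \<ge> \<tau>"
      using v(2) by (intro eventually_conj gds_eventually_small[OF v(4) _ v(3)] eventually_ge_at_top) auto
    then obtain x where x: "gds ?M x (cmod ?\<alpha> / 2) v" "x \<ge> \<tau>"
      using eventually_happens'[OF trivial_limit_at_top_linorder] by blast
    have q: "q \<ge> 2" using v(1) by auto
    \<comment> \<open>The imaginary part rotates \<open>q powr (-s)\<close> by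
      \<open>- (Arg ?\<alpha> + pi)\<close>, so that its product with \<open>?\<alpha>\<close> is a
      negative real number.\<close>
    define s where "s = Complex x ((Arg ?\<alpha> + pi) / ln q)"
    have "of_real q powr (-s) = exp (- of_real (x * ln q) - \<i> * of_real (Arg ?\<alpha> + pi))"
    proof -
      have "s * of_real (ln q) = of_real (x * ln q) + \<i> * of_real (Arg ?\<alpha> + pi)"
        using q by (simp add: s_def complex_eq_iff)
      then show ?thesis using q by (simp add: powr_def Ln_of_real)
    qed
    also have "\<dots> = of_real (exp (- x * ln q)) * exp (- (\<i> * of_real (Arg ?\<alpha>))) * exp (- (\<i> * of_real pi))"
      unfolding exp_of_real[symmetric] exp_add[symmetric]
      by (rule arg_cong[of _ _ exp]) (simp add: algebra_simps)
    also have "exp (- (\<i> * of_real pi)) = (-1 :: complex)" by (simp add: exp_minus)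
    finally have qs: "of_real q powr (-s) = - of_real (exp (- x * ln q)) * exp (- (\<i> * of_real (Arg ?\<alpha>)))"
      by simp
    have "?\<alpha> = of_real (cmod ?\<alpha>) * exp (\<i> * of_real (Arg ?\<alpha>))"
      using Arg_eq[OF v(2)] .
    then have "of_real q powr (-s) * ?\<alpha> = - of_real (exp (- x * ln q)) * of_real (cmod ?\<alpha>) * (exp (- (\<i> * of_real (Arg ?\<alpha>))) * exp (\<i> * of_real (Arg ?\<alpha>)))"
      unfolding qs by (metis (no_types, opaque_lifting) mult.assoc mult.left_commute)
    also have "exp (- (\<i> * of_real (Arg ?\<alpha>))) * exp (\<i> * of_real (Arg ?\<alpha>)) = 1"
      by (simp add: exp_minus)
    finally have lead: "of_real q powr (-s) * ?\<alpha> = - of_real (exp (- x * ln q) * cmod ?\<alpha>)" by simp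
    have "cmod (v s) \<le> cmod ?\<alpha> / 2"
      by (rule gds_bound[OF x(1)]) (use v(3) in \<open>auto simp: s_def\<close>)
    then have rest: "cmod (of_real q powr (-s) * v s) \<le> exp (- x * ln q) * (cmod ?\<alpha> / 2)"
      unfolding norm_mult qs by (intro mult_mono) (auto simp: norm_mult)
    have "w s = of_real q powr (-s) * ?\<alpha> + of_real q powr (-s) * v s"
      using v(5)[of s] x(2) by (simp add: s_def algebra_simps)
    then have "Re (w s) = - (exp (- x * ln q) * cmod ?\<alpha>) + Re (of_real q powr (-s) * v s)"
      unfolding lead by (simp only: plus_complex.sel uminus_complex.sel Re_complex_of_real)
    also have "\<dots> \<le> - (exp (- x * ln q) * cmod ?\<alpha>) + exp (- x * ln q) * (cmod ?\<alpha> / 2)"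
      by (intro add_left_mono order_trans[OF complex_Re_le_cmod rest])
    also have "\<dots> < 0" using v(2) by simp
    finally have "Re (w s) < 0" .
    moreover have "Re (\<phi> s) > \<rho>" by (rule pos) (use x(2) in \<open>simp add: s_def\<close>)
    ultimately show ?thesis by (simp add: w_def)
  qed
qed

text \<open>The constant term \<open>b 1\<close> lies strictly inside the half-plane, so the Taylor
  series of \<open>f\<close> there has a positive radius, and far to the right \<open>w\<close> is
  small enough in norm to be inserted.\<close>

lemma holomorphic_comp_in_D:
  assumes f: "f holomorphic_on half_plane \<rho>" and \<phi>: "in_D \<theta> \<phi>"
    and \<Phi>: "\<And>s. s \<in> half_plane \<theta> \<Longrightarrow> \<Phi> s = \<phi> s" "\<Phi> ` half_plane \<theta> \<subseteq> half_plane \<rho>"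
  shows "in_D \<theta> (\<lambda>s. f (\<Phi> s))"
proof -
  obtain \<tau> C b where \<tau>: "\<tau> > \<theta>" and b: "gds_coeffs Npos \<tau> C b \<phi>" by (rule in_D_imp_gds[OF \<phi>])
  define w where "w s = \<phi> s - b 1" for s
  have "Re (b 1) > \<rho>"
  proof (rule leading_coeff_Re_gt[OF b])
    fix s assume "Re s \<ge> \<tau>"
    then have "s \<in> half_plane \<theta>" using \<tau> by (simp add: half_plane_def)
    then show "Re (\<phi> s) > \<rho>" using \<Phi> by (auto simp: half_plane_def)
  qed
  define r where "r = Re (b 1) - \<rho>"
  have r: "r > 0" using \<open>Re (b 1) > \<rho>\<close> by (simp add: r_def)
  have "ball (b 1) r \<subseteq> half_plane \<rho>"
  proof
    fix z assume "z \<in> ball (b 1) r"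
    then have "cmod (b 1 - z) < r" by (simp add: dist_norm)
    then show "z \<in> half_plane \<rho>" using complex_Re_le_cmod[of "b 1 - z"] by (simp add: half_plane_def r_def)
  qed
  with f have hol: "f holomorphic_on ball (b 1) r" by (rule holomorphic_on_subset)
  define c where "c j = (deriv ^^ j) f (b 1) / fact j" for j
  have ser: "(\<lambda>j. c j * (z - b 1) ^ j) sums f z" if "z \<in> ball (b 1) r" for z
    using holomorphic_power_series[OF hol that] unfolding c_def .
  \<comment> \<open>Convergence at \<open>r / 2\<close> gives absolute convergence at the smaller
    radius \<open>r / 4\<close>, which then serves as the norm bound for \<open>w\<close>.\<close>
  have "summable (\<lambda>j. c j * (of_real (r / 2)) ^ j)"
    using ser[of "b 1 + of_real (r / 2)"] r by (auto simp: dist_norm intro: sums_summable)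
  then have "summable (\<lambda>j. norm (c j * (of_real (r / 4)) ^ j))"
    by (rule powser_insidea) (use r in auto)
  then have sm: "summable (\<lambda>j. cmod (c j) * (r / 4) ^ j)"
    using r by (simp add: norm_mult norm_power norm_divide)
  have "gds (Npos \<inter> {2..}) \<tau> C w"
    using gds_split_constant[OF b] unfolding gds_def w_def by blast
  then have "\<forall>\<^sub>F x in at_top. gds (Npos \<inter> {2..}) x (r / 4) w"
    by (rule gds_eventually_small[where \<delta>=2]) (use r in auto)
  then obtain x where "gds (Npos \<inter> {2..}) x (r / 4) w"
    using eventually_happens'[OF trivial_limit_at_top_linorder] by blast
  then have w: "gds Npos x (r / 4) w" by (rule gds_mono) auto
  have "gds Npos x (\<Sum>j. cmod (c j) * (r / 4) ^ j) (\<lambda>s. \<Sum>j. c j * w s ^ j)"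
    by (rule gds_power_series[OF w sm Npos_ge_1 one_Npos Npos_mult])
  then show ?thesis
  proof (rule gds_imp_in_D)
    fix s assume s: "Re s > x" "Re s > \<theta>"
    have "cmod (w s) \<le> r / 4" by (rule gds_bound[OF w Npos_ge_1]) (use s in auto)
    moreover have "\<Phi> s = b 1 + w s" using \<Phi>(1)[of s] s(2) by (simp add: w_def half_plane_def)
    ultimately have "(\<lambda>j. c j * w s ^ j) sums f (\<Phi> s)"
      using ser[of "\<Phi> s"] r by (simp add: dist_norm)
    then show "(\<Sum>j. c j * w s ^ j) = f (\<Phi> s)" by (simp add: sums_iff)
  qed
qed

section \<open>The equivalence, with zero and positive slope treated separately in the
  converse\<close>

theorem theorem2p1:
  fixes \<theta> :: real and \<Phi> :: "complex \<Rightarrow> complex"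
  assumes "\<Phi> holomorphic_on half_plane \<theta>"
    and "\<Phi> ` half_plane \<theta> \<subseteq> half_plane (1/2)"
  shows "(\<forall>f. f holomorphic_on half_plane (1/2) \<and> in_D (1/2) f
              \<longrightarrow> in_D \<theta> (\<lambda>s. deriv f (\<Phi> s)))
         \<longleftrightarrow> (\<exists>(c\<^sub>0 :: nat) \<phi>. in_D \<theta> \<phi> \<and>
                 (\<forall>s \<in> half_plane \<theta>. \<Phi> s = of_nat c\<^sub>0 * s + \<phi> s))"
proof (intro iffI allI impI)
  assume "\<forall>f. f holomorphic_on half_plane (1/2) \<and> in_D (1/2) f \<longrightarrow> in_D \<theta> (\<lambda>s. deriv f (\<Phi> s))"
  then obtain c :: nat where "in_D \<theta> (\<lambda>s. \<Phi> s - of_nat c * s)"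
    using affine_form_of_comp_in_D[OF assms(1)] by blast
  \<comment> \<open>Taking \<open>\<phi>\<close> as the difference makes the identity hold on the
    whole half-plane, although its series may converge only further right.\<close>
  then show "\<exists>(c\<^sub>0 :: nat) \<phi>. in_D \<theta> \<phi> \<and> (\<forall>s \<in> half_plane \<theta>. \<Phi> s = of_nat c\<^sub>0 * s + \<phi> s)"
    by (intro exI[of _ c] exI[of _ "\<lambda>s. \<Phi> s - of_nat c * s"]) auto
next
  fix f
  assume "\<exists>(c\<^sub>0 :: nat) \<phi>. in_D \<theta> \<phi> \<and> (\<forall>s \<in> half_plane \<theta>. \<Phi> s = of_nat c\<^sub>0 * s + \<phi> s)"
    and f: "f holomorphic_on half_plane (1/2) \<and> in_D (1/2) f"
  then obtain c :: nat and \<phi> where \<phi>: "in_D \<theta> \<phi>" "\<And>s. s \<in> half_plane \<theta> \<Longrightarrow> \<Phi> s = of_nat c * s + \<phi> s"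
    by blast
  show "in_D \<theta> (\<lambda>s. deriv f (\<Phi> s))"
  proof (cases "c = 0")
    case True
    have "open (half_plane (1/2))" unfolding half_plane_def by (rule open_halfspace_Re_gt)
    \<comment> \<open>For slope 0 the function composed with \<open>\<Phi>\<close> is
      \<open>deriv f\<close>, and the mapping property of \<open>\<Phi>\<close> supplies the
      condition on the range.\<close>
    then have "deriv f holomorphic_on half_plane (1/2)" using f by (intro holomorphic_deriv) auto
    then show ?thesis by (rule holomorphic_comp_in_D[OF _ \<phi>(1) _ assms(2)]) (use \<phi>(2) True in simp)
  next
    case False
    then show ?thesis using f by (intro deriv_comp_in_D[OF _ \<phi>(1) _ \<phi>(2)]) auto
  qed
qed

end
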